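(* (i) Let $b>0$ and let $\mu(dx)=\rho(x)dx$ be a probability measure on $[-b,b]$, with $\rho$ smooth, bounded above and bounded away from $0$. If $\rho$ is log-concave and symmetric ($\rho(-x)=\rho(x)$), then the natural unitary orthonormal basis (UOB) associated with $\mu$ has the hypergroup property at the point $-b$; in this case it also has the hypergroup property at the point $b$. (ii) Let $[a,b]$ be any compact interval and $\mu(dx)=\rho(x)dx$ a probability measure on $[a,b]$, with $\rho$ smooth, bounded above and bounded away from $0$. If $\rho$ is log-concave and increasing, then the natural UOB associated with $\mu$ has the hypergroup property at the left end point $a$.
   Context: For a probability measure $\mu(dx)=\rho(x)dx$ on a compact interval $[a,b]$ with $\rho$ smooth, bounded above and away from $0$, let $Lf=f''+\frac{\rho'}{\rho}f'$ with Neumann boundary conditions $f'(a)=f'(b)=0$. The natural UOB associated with $\mu$ is the orthonormal basis $\mathcal{F}=(1=f_0,f_1,\dots,f_n,\dots)$ of the real space $L^2(\mu)$ with $Lf_i=-\lambda_if_i$, $f_i'(a)=f_i'(b)=0$, $0=\lambda_0<\lambda_1<\cdots$ (the eigenvalues being simple), normalized in $L^2(\mu)$ with $f_i(a)>0$. A bounded symmetric operator $K$ on $L^2(\mu)$ is a Markov operator if there is a kernel $k(x,dy)$ of probability measures on $[a,b]$ with $K(f)(x)=\int f(y)\,k(x,dy)$ for every $f\in L^2(\mu)$ and $\mu$-almost every $x$. The UOB $\mathcal{F}$ has the hypergroup property at $x_0\in[a,b]$ if $f_i(x_0)\ne0$ for all $i$ and, for every $x\in[a,b]$, the operator defined by $f_i\mapsto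 \frac{f_i(x)}{f_i(x_0)}f_i$ for all $i$ is a Markov operator. *)

theory Defs
  imports "HOL-Probability.Probability"
begin

text \<open>Elements of the space are represented by functions; equality is almost everywhere
  equality.\<close>

definition L2_fun :: "'a measure \<Rightarrow> ('a \<Rightarrow> real) set" where
  "L2_fun M = {f \<in> borel_measurable M. integrable M (\<lambda>x. (f x)\<^sup>2)}"

definition L2_inner :: "'a measure \<Rightarrow> ('a \<Rightarrow> real) \<Rightarrow> ('a \<Rightarrow> real) \<Rightarrow> real" where
  "L2_inner M f g = (LINT x|M. f x * g x)"

definition L2_norm :: "'a measure \<Rightarrow> ('a \<Rightarrow> real) \<Rightarrow> real" where
  "L2_norm M f = sqrt (L2_inner M f f)"

definition L2_orthonormal_basis :: "'a measure \<Rightarrow> (nat \<Rightarrow> 'a \<Rightarrow> real) \<Rightarrow> bool" where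
  "L2_orthonormal_basis M F \<longleftrightarrow>
     (\<forall>i. F i \<in> L2_fun M) \<and>
     (\<forall>i j. L2_inner M (F i) (F j) = (if i = j then 1 else 0)) \<and>
     (\<forall>g \<in> L2_fun M.
        (\<lambda>n. L2_norm M (\<lambda>x. g x - (\<Sum>i<n. L2_inner M g (F i) * F i x))) \<longlonglongrightarrow> 0)"

text \<open>The second conjunct says that the operator descends to almost-everywhere classes.\<close>

definition bounded_symmetric_operator ::
    "'a measure \<Rightarrow> (('a \<Rightarrow> real) \<Rightarrow> ('a \<Rightarrow> real)) \<Rightarrow> bool" where
  "bounded_symmetric_operator M K \<longleftrightarrow>
     (\<forall>f \<in> L2_fun M. K f \<in> L2_fun M) \<and>
     (\<forall>f \<in> L2_fun M. \<forall>g \<in> L2_fun M.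
        (AE x in M. f x = g x) \<longrightarrow> (AE x in M. K f x = K g x)) \<and>
     (\<forall>f \<in> L2_fun M. \<forall>g \<in> L2_fun M. AE x in M. K (\<lambda>y. f y + g y) x = K f x + K g x) \<and>
     (\<forall>f \<in> L2_fun M. \<forall>c. AE x in M. K (\<lambda>y. c * f y) x = c * K f x) \<and>
     (\<exists>C. \<forall>f \<in> L2_fun M. L2_norm M (K f) \<le> C * L2_norm M f) \<and>
     (\<forall>f \<in> L2_fun M. \<forall>g \<in> L2_fun M. L2_inner M (K f) g = L2_inner M f (K g))"

text \<open>Integrability is demanded explicitly because the Bochner integral of a non-integrable
  function is \<open>0\<close> by convention. The exceptional null set may depend on \<open>f\<close>.\<close>

definition markov_operator ::
    "'a measure \<Rightarrow> (('a \<Rightarrow> real) \<Rightarrow> ('a \<Rightarrow> real)) \<Rightarrow> bool" where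
  "markov_operator M K \<longleftrightarrow>
     bounded_symmetric_operator M K \<and>
     (\<exists>k \<in> measurable M (prob_algebra M).
        \<forall>f \<in> L2_fun M. AE x in M. integrable (k x) f \<and> K f x = (LINT y|k x. f y))"

text \<open>Derivative relative to \<open>[a,b]\<close>: one-sided at the end points.\<close>

definition deriv_on :: "real \<Rightarrow> real \<Rightarrow> (real \<Rightarrow> real) \<Rightarrow> real \<Rightarrow> real" where
  "deriv_on a b f x = vector_derivative f (at x within {a..b})"

definition smooth_on_interval :: "real \<Rightarrow> real \<Rightarrow> (real \<Rightarrow> real) \<Rightarrow> bool" where
  "smooth_on_interval a b f \<longleftrightarrow> (\<forall>n. (deriv_on a b ^^ n) f differentiable_on {a..b})"

definition density_measure :: "real \<Rightarrow> real \<Rightarrow> (real \<Rightarrow> real) \<Rightarrow> real measure" where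
  "density_measure a b \<rho> = density (restrict_space lborel {a..b}) (\<lambda>x. ennreal (\<rho> x))"

definition admissible_density :: "real \<Rightarrow> real \<Rightarrow> (real \<Rightarrow> real) \<Rightarrow> bool" where
  "admissible_density a b \<rho> \<longleftrightarrow>
     a < b \<and>
     smooth_on_interval a b \<rho> \<and>
     (\<exists>C. \<forall>x \<in> {a..b}. \<rho> x \<le> C) \<and>
     (\<exists>c > 0. \<forall>x \<in> {a..b}. c \<le> \<rho> x) \<and>
     prob_space (density_measure a b \<rho>)"

definition log_concave_on :: "real set \<Rightarrow> (real \<Rightarrow> real) \<Rightarrow> bool" where
  "log_concave_on S \<rho> \<longleftrightarrow> concave_on S (\<lambda>x. ln (\<rho> x))"

definition diffusion_op ::
    "real \<Rightarrow> real \<Rightarrow> (real \<Rightarrow> real) \<Rightarrow> (real \<Rightarrow> real) \<Rightarrow> real \<Rightarrow> real" where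
  "diffusion_op a b \<rho> f x =
     deriv_on a b (deriv_on a b f) x + deriv_on a b \<rho> x / \<rho> x * deriv_on a b f x"

definition neumann_eigenfunction ::
    "real \<Rightarrow> real \<Rightarrow> (real \<Rightarrow> real) \<Rightarrow> real \<Rightarrow> (real \<Rightarrow> real) \<Rightarrow> bool" where
  "neumann_eigenfunction a b \<rho> l f \<longleftrightarrow>
     f differentiable_on {a..b} \<and>
     deriv_on a b f differentiable_on {a..b} \<and>
     (\<forall>x \<in> {a..b}. diffusion_op a b \<rho> f x = - l * f x) \<and>
     deriv_on a b f a = 0 \<and> deriv_on a b f b = 0"

text \<open>The eigenfunctions are genuine functions on \<open>[a,b]\<close>, not classes, so that point values make
  sense; their values outside \<open>[a,b]\<close> are irrelevant. Up to these values, the family is uniquely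
  determined by the density.\<close>

definition natural_UOB ::
    "real \<Rightarrow> real \<Rightarrow> (real \<Rightarrow> real) \<Rightarrow> (nat \<Rightarrow> real \<Rightarrow> real) \<Rightarrow> bool" where
  "natural_UOB a b \<rho> F \<longleftrightarrow>
     L2_orthonormal_basis (density_measure a b \<rho>) F \<and>
     (\<forall>x \<in> {a..b}. F 0 x = 1) \<and>
     (\<forall>i. F i a > 0) \<and>
     (\<exists>l :: nat \<Rightarrow> real. l 0 = 0 \<and> strict_mono l \<and>
        (\<forall>i. neumann_eigenfunction a b \<rho> (l i) (F i)))"

text \<open>An operator acting on the basis by the multipliers below is unique, since it is bounded.\<close>

definition hypergroup_property ::
    "real \<Rightarrow> real \<Rightarrow> real measure \<Rightarrow> (nat \<Rightarrow> real \<Rightarrow> real) \<Rightarrow> real \<Rightarrow> bool" where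
  "hypergroup_property a b M F x0 \<longleftrightarrow>
     x0 \<in> {a..b} \<and>
     (\<forall>i. F i x0 \<noteq> 0) \<and>
     (\<forall>x \<in> {a..b}. \<exists>K. markov_operator M K \<and>
        (\<forall>i. AE y in M. K (F i) y = F i x / F i x0 * F i y))"

end

theory Submission imports Defs begin

text \<open>
  Write \<open>K\<close> for the operator with multipliers \<open>F i x / F i a\<close>. It sends \<open>f = (\<Sum>i<n. d i * F i)\<close> to
  \<open>u(x, \<cdot>)\<close>, where \<open>u(x, y) = (\<Sum>i<n. d i * F i x * F i y / F i a)\<close>. This \<open>u\<close> solves the
  hyperbolic equation \<open>L\<^sub>x u = L\<^sub>y u\<close> with Cauchy data \<open>u = f\<close>, \<open>u\<^sub>y = 0\<close> on the side \<open>y = a\<close>. The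
  heart of the matter is that \<open>f \<ge> 0\<close> implies \<open>u \<ge> 0\<close>; adding a small constant to \<open>f\<close>, it is enough
  that \<open>f > 0\<close> implies \<open>u > 0\<close>.

  Put \<open>R(x, y) = \<rho> x * \<rho> y\<close> and \<open>p = \<rho>' / \<rho>\<close>. In divergence form the equation reads
  \<open>(R u\<^sub>x)\<^sub>x = (R u\<^sub>y)\<^sub>y\<close>, so there is a conjugate function \<open>v\<close> with \<open>v\<^sub>x = R u\<^sub>y\<close> and \<open>v\<^sub>y = R u\<^sub>x\<close>,
  and by the Neumann conditions \<open>v\<close> vanishes on the boundary of the square. Along a
  characteristic line \<open>t \<mapsto> (q + s t, t)\<close> with \<open>s = 1\<close> or \<open>s = -1\<close> all derivatives of \<open>u\<close> and \<open>v\<close>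
  cancel in \<open>R u - s v\<close>, whose derivative is \<open>R u (s p(x) + p(y))\<close>
  (\<open>DERIV_characteristic\<close>). Suppose that \<open>u \<le> 0\<close> somewhere, take such a point
  with smallest \<open>y\<close>, and follow both characteristics down from it. If \<open>p(y) \<ge> p(x)\<close> and \<open>p(x) + p(y) \<ge> 0\<close> along them, then \<open>R u - v\<close> and
  \<open>R u + v\<close> at that point are at least the positive values of \<open>R u\<close> at the two feet, where
  \<open>v = 0\<close>; adding the two inequalities contradicts \<open>u \<le> 0\<close> (\<open>wave_positive\<close>). For \<open>y \<le> x\<close> the
  first condition on \<open>p\<close> is log-concavity. The second one holds everywhere if \<open>\<rho>\<close> increases,
  and for \<open>y \<le> -x\<close> if \<open>\<rho>\<close> is even. The rest of the square follows from \<open>u(x, y) = u(y, x)\<close> and,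
  for even \<open>\<rho>\<close>, from \<open>u(-x, -y) = u(x, y)\<close>, because each eigenfunction is then even or odd
  (\<open>eigenfunction_parity\<close>).

  Positivity turns \<open>f \<mapsto> u(x, y)\<close> into a positive normalized functional on the span of the
  eigenfunctions. The span is uniformly dense in the continuous functions (\<open>uniform_approx\<close>), so
  the functional is integration against a probability measure (\<open>moment_problem_Icc\<close>). These
  measures form a kernel in \<open>y\<close>; it leaves the given measure invariant because a probability
  measure is determined by its integrals of the \<open>F i\<close> (\<open>measure_eqI_moments\<close>). By Jensen's
  inequality an invariant kernel contracts \<open>L\<^sup>2\<close>, and being diagonal in an orthonormal basis it is
  symmetric (\<open>markov_operator_kernel_op\<close>).
\<close>

section \<open>Square integrable functions\<close>

lemma (in prob_space) expectation_square_le: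
  fixes X :: "'a \<Rightarrow> real"
  assumes "X \<in> borel_measurable M" "integrable M (\<lambda>x. (X x)\<^sup>2)"
  shows "(expectation X)\<^sup>2 \<le> expectation (\<lambda>x. (X x)\<^sup>2)"
  using variance_eq[OF square_integrable_imp_integrable[OF assms] assms(2)] variance_positive[of X] by simp

lemma L2_product_integrable:
  assumes "f \<in> L2_fun M" "g \<in> L2_fun M"
  shows "integrable M (\<lambda>x. f x * g x)"
proof (rule Bochner_Integration.integrable_bound)
  show "integrable M (\<lambda>x. (f x)\<^sup>2 + (g x)\<^sup>2)" "(\<lambda>x. f x * g x) \<in> borel_measurable M"
    using assms by (auto simp: L2_fun_def)
  have "\<bar>u\<bar> * \<bar>v\<bar> \<le> u\<^sup>2 + v\<^sup>2" for u v :: real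
    using sum_squares_bound[of "\<bar>u\<bar>" "\<bar>v\<bar>"] mult_nonneg_nonneg[OF abs_ge_zero[of u] abs_ge_zero[of v]]
    unfolding power2_abs mult.assoc by linarith
  then have "norm (u * v) \<le> norm (u\<^sup>2 + v\<^sup>2)" for u v :: real
    by (simp add: abs_mult)
  then show "AE x in M. norm (f x * g x) \<le> norm ((f x)\<^sup>2 + (g x)\<^sup>2)" by simp
qed

lemma L2_fun_add:
  assumes "f \<in> L2_fun M" "g \<in> L2_fun M"
  shows "(\<lambda>x. f x + g x) \<in> L2_fun M"
  using assms L2_product_integrable[OF assms]
  by (auto simp: L2_fun_def power2_sum mult.assoc)

lemma L2_fun_scale: "f \<in> L2_fun M \<Longrightarrow> (\<lambda>x. c * f x) \<in> L2_fun M"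
  by (auto simp: L2_fun_def power_mult_distrib)

lemma L2_fun_diff:
  assumes "f \<in> L2_fun M" "g \<in> L2_fun M"
  shows "(\<lambda>x. f x - g x) \<in> L2_fun M"
  using L2_fun_add[OF assms(1) L2_fun_scale[OF assms(2), of "-1"]] by simp

lemma L2_fun_sum:
  "(\<And>i. f i \<in> L2_fun M) \<Longrightarrow> (\<lambda>x. \<Sum>i<(n::nat). c i * f i x) \<in> L2_fun M"
proof (induction n)
  case 0
  show ?case by (simp add: L2_fun_def)
next
  case (Suc n)
  then show ?case by (simp add: L2_fun_add L2_fun_scale)
qed

text \<open>The quadratic polynomial \<open>s \<mapsto> \<parallel>f + s g\<parallel>\<^sup>2\<close> is nonnegative.\<close>

lemma L2_Cauchy_Schwarz:
  assumes f: "f \<in> L2_fun M" and g: "g \<in> L2_fun M"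
  shows "\<bar>L2_inner M f g\<bar> \<le> L2_norm M f * L2_norm M g"
proof -
  note fg = L2_product_integrable[OF f g] and ff = L2_product_integrable[OF f f]
    and gg = L2_product_integrable[OF g g]
  have quad: "0 \<le> L2_inner M f f + 2 * s * L2_inner M f g + s\<^sup>2 * L2_inner M g g" for s
  proof -
    have "0 \<le> (LINT x|M. (f x + s * g x)\<^sup>2)" by simp
    also have "\<dots> = (LINT x|M. f x * f x + (2 * s) * (f x * g x) + s\<^sup>2 * (g x * g x))"
      by (simp add: power2_eq_square algebra_simps)
    also have "\<dots> = L2_inner M f f + 2 * s * L2_inner M f g + s\<^sup>2 * L2_inner M g g"
      unfolding L2_inner_def using fg ff gg by simp
    finally show ?thesis .
  qed
  have nn: "0 \<le> L2_inner M f f" "0 \<le> L2_inner M g g"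
    unfolding L2_inner_def by (auto intro!: integral_nonneg_AE)
  have "(L2_inner M f g)\<^sup>2 \<le> L2_inner M f f * L2_inner M g g"
  proof (cases "L2_inner M g g = 0")
    case True
    have "L2_inner M f g = 0"
    proof (rule ccontr)
      assume "L2_inner M f g \<noteq> 0"
      \<comment> \<open>The polynomial is then linear and not constant; at this \<open>s\<close> its value is \<open>-1\<close>.\<close>
      then show False
        using quad[of "- (L2_inner M f f + 1) / (2 * L2_inner M f g)"] True by (simp add: field_simps)
    qed
    then show ?thesis by (simp add: True)
  next
    case False
    then have "0 < L2_inner M g g" using nn by simp
    moreover have "0 \<le> L2_inner M f f - (L2_inner M f g)\<^sup>2 / L2_inner M g g"
      using quad[of "- L2_inner M f g / L2_inner M g g"] False
      by (simp add: power2_eq_square field_simps)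
    ultimately show ?thesis by (simp add: field_simps)
  qed
  then have "sqrt ((L2_inner M f g)\<^sup>2) \<le> sqrt (L2_inner M f f * L2_inner M g g)" by (rule real_sqrt_le_mono)
  then show ?thesis by (simp add: L2_norm_def real_sqrt_mult)
qed

section \<open>Markov operators from invariant kernels\<close>

locale invariant_kernel = prob_space M for M :: "'a measure" +
  fixes k :: "'a \<Rightarrow> 'a measure"
  assumes kernel: "k \<in> measurable M (prob_algebra M)"
    and invariant: "M \<bind> k = M"
begin

definition kernel_op :: "('a \<Rightarrow> real) \<Rightarrow> 'a \<Rightarrow> real" where
  "kernel_op f x = (LINT y|k x. f y)"

lemma kernel_subprob: "k \<in> measurable M (subprob_algebra M)"
  by (rule measurable_prob_algebraD[OF kernel])

lemma prob_kernel: "x \<in> space M \<Longrightarrow> prob_space (k x)"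
  and sets_kernel: "x \<in> space M \<Longrightarrow> sets (k x) = sets M"
  using measurable_space[OF kernel] by (auto simp: space_prob_algebra)

lemma kernel_op_measurable: "f \<in> borel_measurable M \<Longrightarrow> kernel_op f \<in> borel_measurable M"
  unfolding kernel_op_def by (rule measurable_compose[OF kernel_subprob integral_measurable_subprob_algebra])

lemma nn_integral_kernel:
  "f \<in> borel_measurable M \<Longrightarrow> (\<integral>\<^sup>+x. (\<integral>\<^sup>+y. f y \<partial>k x) \<partial>M) = (\<integral>\<^sup>+x. f x \<partial>M)"
  using nn_integral_bind[OF _ kernel_subprob] invariant by metis

text \<open>Invariance makes the second moments \<open>\<integral> f\<^sup>2 dk(x)\<close> integrable in \<open>x\<close>, hence finite for almost
  every \<open>x\<close>; for those \<open>x\<close> Jensen's inequality applies to the probability measure \<open>k x\<close>.\<close>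

lemma kernel_op_square_bound:
  assumes f: "f \<in> L2_fun M"
  shows "AE x in M. integrable (k x) f \<and> ennreal ((kernel_op f x)\<^sup>2) \<le> (\<integral>\<^sup>+y. ennreal ((f y)\<^sup>2) \<partial>k x)"
proof -
  have fm [measurable]: "f \<in> borel_measurable M" and sq: "integrable M (\<lambda>x. (f x)\<^sup>2)"
    using f by (auto simp: L2_fun_def)
  have "(\<integral>\<^sup>+x. (\<integral>\<^sup>+y. ennreal ((f y)\<^sup>2) \<partial>k x) \<partial>M) = (\<integral>\<^sup>+x. ennreal ((f x)\<^sup>2) \<partial>M)"
    by (rule nn_integral_kernel) measurable
  also have "\<dots> < \<infinity>" using sq by (simp add: integrable_iff_bounded)
  finally have "AE x in M. (\<integral>\<^sup>+y. ennreal ((f y)\<^sup>2) \<partial>k x) \<noteq> \<infinity>"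
    by (intro nn_integral_PInf_AE measurable_compose[OF kernel_subprob nn_integral_measurable_subprob_algebra]) auto
  then show ?thesis
  proof (rule AE_mp, intro AE_I2 impI)
    fix x assume x: "x \<in> space M" and fin: "(\<integral>\<^sup>+y. ennreal ((f y)\<^sup>2) \<partial>k x) \<noteq> \<infinity>"
    interpret kx: prob_space "k x" by (rule prob_kernel[OF x])
    have m: "f \<in> borel_measurable (k x)"
      using fm by (simp add: measurable_cong_sets[OF sets_kernel[OF x] refl])
    then have int: "integrable (k x) (\<lambda>y. (f y)\<^sup>2)"
      using fin by (intro integrableI_nonneg) (auto simp: less_top)
    have "ennreal ((kernel_op f x)\<^sup>2) \<le> ennreal (LINT y|k x. (f y)\<^sup>2)"
      unfolding kernel_op_def by (intro ennreal_leI kx.expectation_square_le m int)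
    also have "\<dots> = (\<integral>\<^sup>+y. ennreal ((f y)\<^sup>2) \<partial>k x)"
      by (rule nn_integral_eq_integral[symmetric, OF int]) simp
    finally show "integrable (k x) f \<and> ennreal ((kernel_op f x)\<^sup>2) \<le> (\<integral>\<^sup>+y. ennreal ((f y)\<^sup>2) \<partial>k x)"
      using kx.square_integrable_imp_integrable[OF m int] by blast
  qed
qed

lemma kernel_op_contraction:
  assumes f: "f \<in> L2_fun M"
  shows "kernel_op f \<in> L2_fun M" "L2_norm M (kernel_op f) \<le> L2_norm M f"
proof -
  have [measurable]: "f \<in> borel_measurable M" and sq: "integrable M (\<lambda>x. (f x)\<^sup>2)"
    using f by (auto simp: L2_fun_def)
  have [measurable]: "kernel_op f \<in> borel_measurable M" by (rule kernel_op_measurable) measurable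
  have "(\<integral>\<^sup>+x. ennreal ((kernel_op f x)\<^sup>2) \<partial>M) \<le> (\<integral>\<^sup>+x. (\<integral>\<^sup>+y. ennreal ((f y)\<^sup>2) \<partial>k x) \<partial>M)"
    by (intro nn_integral_mono_AE) (use kernel_op_square_bound[OF f] in \<open>auto elim: eventually_mono\<close>)
  also have "\<dots> = (\<integral>\<^sup>+x. ennreal ((f x)\<^sup>2) \<partial>M)" by (rule nn_integral_kernel) measurable
  finally have le: "(\<integral>\<^sup>+x. ennreal ((kernel_op f x)\<^sup>2) \<partial>M) \<le> (\<integral>\<^sup>+x. ennreal ((f x)\<^sup>2) \<partial>M)" .
  also have "\<dots> < \<infinity>" using sq by (simp add: integrable_iff_bounded)
  finally have sq': "integrable M (\<lambda>x. (kernel_op f x)\<^sup>2)" by (intro integrableI_nonneg) auto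
  then show "kernel_op f \<in> L2_fun M" by (simp add: L2_fun_def)
  have "ennreal (LINT x|M. (kernel_op f x)\<^sup>2) \<le> ennreal (LINT x|M. (f x)\<^sup>2)"
    using le by (simp add: nn_integral_eq_integral sq sq')
  then have "(LINT x|M. (kernel_op f x)\<^sup>2) \<le> (LINT x|M. (f x)\<^sup>2)"
    by (simp add: ennreal_le_iff)
  then show "L2_norm M (kernel_op f) \<le> L2_norm M f"
    by (simp add: L2_norm_def L2_inner_def power2_eq_square)
qed

lemma kernel_op_cong_AE:
  assumes "f \<in> L2_fun M" "g \<in> L2_fun M" and eq: "AE x in M. f x = g x"
  shows "AE x in M. kernel_op f x = kernel_op g x"
proof -
  have fg [measurable]: "f \<in> borel_measurable M" "g \<in> borel_measurable M"
    using assms by (auto simp: L2_fun_def)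
  have "AE y in M \<bind> k. f y = g y" unfolding invariant by (rule eq)
  then have "AE x in M. AE y in k x. f y = g y"
    by (subst (asm) AE_bind[OF kernel_subprob]) measurable
  then show ?thesis
  proof (rule AE_mp, intro AE_I2 impI)
    fix x assume x: "x \<in> space M" and "AE y in k x. f y = g y"
    then show "kernel_op f x = kernel_op g x"
      unfolding kernel_op_def by (intro integral_cong_AE) (auto simp: measurable_cong_sets[OF sets_kernel[OF x] refl])
  qed
qed

lemma kernel_op_add:
  assumes "f \<in> L2_fun M" "g \<in> L2_fun M"
  shows "AE x in M. kernel_op (\<lambda>y. f y + g y) x = kernel_op f x + kernel_op g x"
  using kernel_op_square_bound[OF assms(1)] kernel_op_square_bound[OF assms(2)]
  by eventually_elim (simp add: kernel_op_def)

lemma kernel_op_scale: "kernel_op (\<lambda>y. c * f y) x = c * kernel_op f x"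
  by (simp add: kernel_op_def)

lemma kernel_op_sum:
  assumes F: "\<And>i. F i \<in> L2_fun M"
  shows "AE x in M. kernel_op (\<lambda>y. \<Sum>i<(n::nat). c i * F i y) x = (\<Sum>i<n. c i * kernel_op (F i) x)"
proof -
  have "AE x in M. \<forall>i. integrable (k x) (F i)"
    using kernel_op_square_bound[OF F] by (simp add: AE_all_countable)
  then show ?thesis by eventually_elim (simp add: kernel_op_def)
qed

text \<open>On partial sums of the expansion of \<open>f\<close> the form \<open>\<langle>K f, g\<rangle>\<close> is
  \<open>\<Sum> m\<^sub>i \<langle>f, F\<^sub>i\<rangle> \<langle>F\<^sub>i, g\<rangle>\<close>, which is symmetric in \<open>f\<close> and \<open>g\<close>; the contraction property lets the
  partial sums converge.\<close>

lemma kernel_op_symmetric: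
  assumes onb: "L2_orthonormal_basis M F"
    and diag: "\<And>i. AE x in M. kernel_op (F i) x = m i * F i x"
    and f: "f \<in> L2_fun M" and g: "g \<in> L2_fun M"
  shows "L2_inner M (kernel_op f) g = L2_inner M f (kernel_op g)"
proof -
  have F: "F i \<in> L2_fun M" for i using onb by (simp add: L2_orthonormal_basis_def)
  have lim: "(\<lambda>n. \<Sum>i<n. L2_inner M f (F i) * (m i * L2_inner M (F i) g)) \<longlonglongrightarrow> L2_inner M (kernel_op f) g"
    if f: "f \<in> L2_fun M" and g: "g \<in> L2_fun M" for f g
  proof -
    define r where "r n x = f x - (\<Sum>i<n. L2_inner M f (F i) * F i x)" for n x
    have r: "r n \<in> L2_fun M" for n unfolding r_def by (intro L2_fun_diff L2_fun_sum f F)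
    have meas: "kernel_op h \<in> borel_measurable M" "h \<in> borel_measurable M" if "h \<in> L2_fun M" for h
      using kernel_op_contraction(1)[OF that] that by (auto simp: L2_fun_def)
    have split: "L2_inner M (kernel_op f) g - (\<Sum>i<n. L2_inner M f (F i) * (m i * L2_inner M (F i) g))
      = L2_inner M (kernel_op (r n)) g" for n
    proof -
      have "AE x in M. kernel_op (r n) x = kernel_op f x - (\<Sum>i<n. L2_inner M f (F i) * kernel_op (F i) x)"
        using kernel_op_add[OF r[of n] L2_fun_sum[where f = F and n = n and c = "\<lambda>i. L2_inner M f (F i)", OF F]] 
          kernel_op_sum[where F = F and n = n and c = "\<lambda>i. L2_inner M f (F i)", OF F]
        by eventually_elim (simp add: r_def)
      moreover have "AE x in M. \<forall>i. kernel_op (F i) x = m i * F i x"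
        using diag by (simp add: AE_all_countable)
      ultimately have "AE x in M. kernel_op (r n) x * g x
         = kernel_op f x * g x - (\<Sum>i<n. L2_inner M f (F i) * (m i * (F i x * g x)))"
        by eventually_elim (simp add: left_diff_distrib right_diff_distrib sum_distrib_right sum_distrib_left mult_ac)
      then have "L2_inner M (kernel_op (r n)) g
         = (LINT x|M. kernel_op f x * g x - (\<Sum>i<n. L2_inner M f (F i) * (m i * (F i x * g x))))"
        unfolding L2_inner_def
        using meas[OF r] meas[OF f] meas[OF g] meas[OF F] by (intro integral_cong_AE) auto
      also have "\<dots> = L2_inner M (kernel_op f) g - (\<Sum>i<n. L2_inner M f (F i) * (m i * L2_inner M (F i) g))"
        unfolding L2_inner_def using L2_product_integrable[OF F g] L2_product_integrable[OF kernel_op_contraction(1)[OF f] g]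
        by simp
      finally show ?thesis by simp
    qed
    have "(\<lambda>n. L2_norm M (r n) * L2_norm M g) \<longlonglongrightarrow> 0 * L2_norm M g"
      using onb f unfolding r_def L2_orthonormal_basis_def by (intro tendsto_intros) blast
    moreover have "\<bar>L2_inner M (kernel_op (r n)) g\<bar> \<le> L2_norm M (r n) * L2_norm M g" for n
    proof -
      have "\<bar>L2_inner M (kernel_op (r n)) g\<bar> \<le> L2_norm M (kernel_op (r n)) * L2_norm M g"
        by (intro L2_Cauchy_Schwarz kernel_op_contraction r g)
      also have "\<dots> \<le> L2_norm M (r n) * L2_norm M g"
        by (intro mult_right_mono kernel_op_contraction r) (simp add: L2_norm_def L2_inner_def integral_nonneg_AE)
      finally show ?thesis .
    qed
    ultimately have "(\<lambda>n. L2_inner M (kernel_op (r n)) g) \<longlonglongrightarrow> 0"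
      by (intro Lim_null_comparison[of "\<lambda>n. L2_inner M (kernel_op (r n)) g"]) auto
    then have "(\<lambda>n. L2_inner M (kernel_op f) g - L2_inner M (kernel_op (r n)) g) \<longlonglongrightarrow> L2_inner M (kernel_op f) g - 0"
      by (intro tendsto_intros)
    then show ?thesis by (simp add: split[symmetric])
  qed
  have comm: "L2_inner M u v = L2_inner M v u" for u v by (simp add: L2_inner_def mult.commute)
  have "(\<lambda>n. \<Sum>i<n. L2_inner M f (F i) * (m i * L2_inner M (F i) g)) \<longlonglongrightarrow> L2_inner M f (kernel_op g)"
    using lim[OF g f] by (simp add: comm[of _ f] comm[of _ g] mult_ac)
  with lim[OF f g] show ?thesis by (rule LIMSEQ_unique)
qed

theorem markov_operator_kernel_op:
  assumes onb: "L2_orthonormal_basis M F"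
    and diag: "\<And>i. AE x in M. kernel_op (F i) x = m i * F i x"
  shows "markov_operator M kernel_op"
  unfolding markov_operator_def bounded_symmetric_operator_def
proof (intro conjI ballI allI impI)
  show "\<exists>C. \<forall>f\<in>L2_fun M. L2_norm M (kernel_op f) \<le> C * L2_norm M f"
    using kernel_op_contraction(2) by (intro exI[of _ 1]) simp
  show "\<exists>k\<in>M \<rightarrow>\<^sub>M prob_algebra M. \<forall>f\<in>L2_fun M. AE x in M. integrable (k x) f \<and> kernel_op f x = (LINT y|k x. f y)"
    by (intro bexI[OF _ kernel] ballI, drule kernel_op_square_bound) (auto simp: kernel_op_def elim: eventually_mono)
  show "AE x in M. kernel_op f x = kernel_op g x" if "f \<in> L2_fun M" "g \<in> L2_fun M" "AE x in M. f x = g x" for f g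
    using that by (rule kernel_op_cong_AE)
qed (simp_all add: kernel_op_contraction(1) kernel_op_scale kernel_op_add kernel_op_symmetric[OF onb diag])

end

section \<open>Positive functionals and moments on an interval\<close>

text \<open>The weights \<open>\<Lambda> B\<^sub>n\<^sub>k\<close> of the Bernstein polynomials, placed at the nodes \<open>k / n\<close> rescaled to the
  interval, form probability measures \<open>\<mu> n\<close> with \<open>\<integral> h d\<mu> n = \<Lambda> (B\<^sub>n h)\<close>, where \<open>B\<^sub>n h\<close> is the Bernstein
  approximation of \<open>h\<close>. All of them live on the same compact interval, so by Helly's theorem a subsequence
  converges weakly, and its limit represents \<open>\<Lambda>\<close> because \<open>B\<^sub>n h\<close> converges uniformly to \<open>h\<close>.\<close>

theorem riesz_representation_Icc:
  fixes a b :: real and \<Lambda> :: "(real \<Rightarrow> real) \<Rightarrow> real"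
  assumes ab: "a < b"
    and add: "\<And>g h. continuous_on {a..b} g \<Longrightarrow> continuous_on {a..b} h \<Longrightarrow> \<Lambda> (\<lambda>z. g z + h z) = \<Lambda> g + \<Lambda> h"
    and scale: "\<And>c h. continuous_on {a..b} h \<Longrightarrow> \<Lambda> (\<lambda>z. c * h z) = c * \<Lambda> h"
    and pos: "\<And>h. continuous_on {a..b} h \<Longrightarrow> (\<And>z. z \<in> {a..b} \<Longrightarrow> 0 \<le> h z) \<Longrightarrow> 0 \<le> \<Lambda> h"
    and one: "\<Lambda> (\<lambda>_. 1) = 1"
  shows "\<exists>\<nu>. prob_space \<nu> \<and> sets \<nu> = sets (restrict_space borel {a..b}) \<and>
    (\<forall>h. continuous_on {a..b} h \<longrightarrow> integral\<^sup>L \<nu> h = \<Lambda> h)"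
proof -
  define \<phi> where "\<phi> s = a + (b - a) * s" for s
  define \<psi> where "\<psi> z = (z - a) / (b - a)" for z
  have \<psi>\<phi>: "\<phi> (\<psi> z) = z" for z using ab by (simp add: \<phi>_def \<psi>_def)
  have \<psi>: "\<psi> z \<in> {0..1}" if "z \<in> {a..b}" for z using that ab by (auto simp: \<psi>_def field_simps)
  have \<phi>: "\<phi> s \<in> {a..b}" if "s \<in> {0..1}" for s
  proof -
    have "0 \<le> (b - a) * s" "(b - a) * s \<le> (b - a) * 1"
      using that ab by (auto intro!: mult_left_mono)
    then show ?thesis by (simp add: \<phi>_def)
  qed
  define B where "B n k z = Bernstein n k (\<psi> z)" for n k z
  define node where "node n k = \<phi> (real k / real n)" for n k :: nat
  have node: "node n k \<in> {a..b}" if "k \<le> n" for n k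
    unfolding node_def using that by (intro \<phi>) (cases "n = 0", auto simp: field_simps)
  have B_cont: "continuous_on {a..b} (B n k)" for n k
    unfolding B_def Bernstein_def \<psi>_def using ab by (auto intro!: continuous_intros)
  have B_nonneg: "0 \<le> B n k z" if "z \<in> {a..b}" for n k z
    unfolding B_def using \<psi>[OF that] by (intro Bernstein_nonneg) auto
  have sum: "\<Lambda> (\<lambda>z. \<Sum>k\<in>K. g k z) = (\<Sum>k\<in>K. \<Lambda> (g k))"
    if "finite K" "\<And>k. continuous_on {a..b} (g k)" for K :: "nat set" and g
    using that
  proof (induction K rule: finite_induct)
    case empty
    show ?case using scale[of "\<lambda>_. 1" 0] by simp
  next
    case (insert k K)
    then show ?case using add[of "g k" "\<lambda>z. \<Sum>k\<in>K. g k z"] by (simp add: continuous_intros)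
  qed
  have near: "\<bar>\<Lambda> g - \<Lambda> h\<bar> \<le> e"
    if c: "continuous_on {a..b} g" "continuous_on {a..b} h"
      and e: "\<And>z. z \<in> {a..b} \<Longrightarrow> \<bar>g z - h z\<bar> \<le> e" for g h e
  proof -
    have le: "\<Lambda> g \<le> \<Lambda> h + e"
      if c: "continuous_on {a..b} g" "continuous_on {a..b} h"
        and e: "\<And>z. z \<in> {a..b} \<Longrightarrow> g z - h z \<le> e" for g h
    proof -
      have "0 \<le> \<Lambda> (\<lambda>z. (h z + (- 1) * g z) + e * 1)"
        using c e by (intro pos continuous_intros) (auto simp: algebra_simps)
      also have "\<dots> = \<Lambda> (\<lambda>z. h z + (- 1) * g z) + \<Lambda> (\<lambda>z. e * 1)"
        by (intro add continuous_intros c)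
      also have "\<Lambda> (\<lambda>z. h z + (- 1) * g z) = \<Lambda> h + \<Lambda> (\<lambda>z. (- 1) * g z)"
        by (intro add continuous_intros c)
      also have "\<Lambda> (\<lambda>z. (- 1) * g z) = (- 1) * \<Lambda> g" by (intro scale c)
      also have "\<Lambda> (\<lambda>z. e * 1) = e" using scale[of "\<lambda>_. 1" e] one by simp
      finally show ?thesis by simp
    qed
    have "g z - h z \<le> e" "h z - g z \<le> e" if "z \<in> {a..b}" for z using e[OF that] by auto
    then show ?thesis using le[OF c] le[OF c(2,1)] by (simp add: abs_le_iff)
  qed
  define w where "w n k = \<Lambda> (B n k)" for n k
  have w_nonneg: "0 \<le> w n k" for n k unfolding w_def by (intro pos B_cont B_nonneg)
  have w_sum: "(\<Sum>k\<le>n. w n k) = 1" for n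
    unfolding w_def using sum[of "{..n}" "B n"] B_cont one by (simp add: B_def sum_Bernstein)
  define P where "P n = point_measure {..n} (\<lambda>k. ennreal (w n k))" for n
  define \<mu> where "\<mu> n = distr (P n) borel (node n)" for n
  have P_prob: "prob_space (P n)" for n
    unfolding P_def using w_nonneg w_sum by (intro prob_spaceI)
      (simp add: emeasure_point_measure_finite space_point_measure)
  have node_meas [measurable]: "node n \<in> borel_measurable (P n)" for n
    by (simp add: P_def point_measure_def)
  have \<mu>_real: "real_distribution (\<mu> n)" for n
    unfolding \<mu>_def real_distribution_def real_distribution_axioms_def
    by (auto intro!: prob_space.prob_space_distr P_prob)
  have integral_\<mu>: "integral\<^sup>L (\<mu> n) h = (\<Sum>k\<le>n. w n k * h (node n k))"
    if "h \<in> borel_measurable borel" for n and h :: "real \<Rightarrow> real"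
    unfolding \<mu>_def using that w_nonneg
    by (subst integral_distr) (auto simp: P_def lebesgue_integral_point_measure_finite point_measure_def[symmetric])
  have "tight \<mu>"
    unfolding tight_def
  proof (intro conjI allI impI \<mu>_real)
    fix e :: real assume e: "0 < e"
    have "1 - e < measure (\<mu> n) {a - 1<..b}" for n
    proof -
      interpret Pn: prob_space "P n" by (rule P_prob)
      have "node n -` {a - 1<..b} \<inter> space (P n) = space (P n)"
        using node by (force simp: P_def space_point_measure)
      then have "measure (\<mu> n) {a - 1<..b} = 1"
        unfolding \<mu>_def by (subst measure_distr) (auto simp: Pn.prob_space)
      then show ?thesis using e by simp
    qed
    then show "\<exists>x y. x < y \<and> (\<forall>n. 1 - e < measure (\<mu> n) {x<..y})"
      using ab by (intro exI[of _ "a - 1"] exI[of _ b]) simp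
  qed
  from tight_imp_convergent_subsubsequence[OF this, of id]
  obtain r N where r: "strict_mono r" and N: "real_distribution N" and w: "weak_conv_m (\<mu> \<circ> r) N"
    by (auto simp: strict_mono_def)
  interpret N: real_distribution N by (rule N)
  have lim: "(\<lambda>n. integral\<^sup>L (\<mu> (r n)) H) \<longlonglongrightarrow> integral\<^sup>L N H"
    if "\<And>x. isCont H x" "\<And>x. norm (H x) \<le> C" for H :: "real \<Rightarrow> real" and C
    using weak_conv_imp_integral_bdd_continuous_conv[of "\<mu> \<circ> r" N H C] w that \<mu>_real N by simp
  \<comment> \<open>Weak convergence needs test functions on the whole line: extend constantly outside the interval.\<close>
  define clamp where "clamp z = max a (min b z)" for z
  have clamp: "clamp z \<in> {a..b}" for z using ab by (auto simp: clamp_def)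
  have clamp_id: "clamp z = z" if "z \<in> {a..b}" for z using that by (auto simp: clamp_def)
  have clamp_cont: "continuous_on UNIV clamp" unfolding clamp_def by (intro continuous_intros)
  \<comment> \<open>The truncated distance to the interval has integral zero under every \<open>\<mu> n\<close>.\<close>
  have conc: "AE z in N. z \<in> {a..b}"
  proof -
    define H where "H z = min 1 \<bar>z - clamp z\<bar>" for z
    have cH: "continuous_on UNIV H" unfolding H_def by (intro continuous_intros clamp_cont)
    have [measurable]: "H \<in> borel_measurable borel" by (rule borel_measurable_continuous_onI[OF cH])
    have "integral\<^sup>L (\<mu> n) H = 0" for n
      by (subst integral_\<mu>) (auto simp: H_def clamp_id[OF node])
    moreover have "isCont H x" for x using cH by (simp add: continuous_on_eq_continuous_at)
    moreover have "norm (H x) \<le> 1" for x by (simp add: H_def)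
    ultimately have "integral\<^sup>L N H = 0" using lim[of H 1] by (simp add: LIMSEQ_const_iff)
    moreover have "integrable N H"
      by (rule N.integrable_const_bound[of _ 1]) (auto simp: H_def)
    ultimately have "AE z in N. H z = 0"
      by (subst (asm) integral_nonneg_eq_0_iff_AE) (auto simp: H_def)
    moreover have "z \<in> {a..b}" if "H z = 0" for z
      using that clamp[of z] by (simp add: H_def min_def split: if_splits)
    ultimately show ?thesis by (auto elim: eventually_mono)
  qed
  have integral_N: "(LINT z|N. h (clamp z)) = \<Lambda> h" if h: "continuous_on {a..b} h" for h
  proof -
    have cH: "continuous_on UNIV (\<lambda>z. h (clamp z))"
      by (rule continuous_on_compose2[OF h clamp_cont]) (use clamp in auto)
    have mH: "(\<lambda>z. h (clamp z)) \<in> borel_measurable borel" by (rule borel_measurable_continuous_onI[OF cH])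
    obtain C where C: "\<And>z. z \<in> {a..b} \<Longrightarrow> norm (h z) \<le> C"
      using compact_imp_bounded[OF compact_continuous_image[OF h compact_Icc]]
      unfolding bounded_iff by blast
    have "(\<lambda>n. integral\<^sup>L (\<mu> (r n)) (\<lambda>z. h (clamp z))) \<longlonglongrightarrow> (LINT z|N. h (clamp z))"
      using cH C[OF clamp] by (intro lim) (auto simp: continuous_on_eq_continuous_at)
    moreover have "(\<lambda>n. integral\<^sup>L (\<mu> n) (\<lambda>z. h (clamp z))) \<longlonglongrightarrow> \<Lambda> h"
    proof (rule LIMSEQ_I)
      fix e :: real assume e: "0 < e"
      have c\<phi>: "continuous_on {0..1} (h \<circ> \<phi>)"
        using \<phi> by (intro continuous_on_compose continuous_on_subset[OF h]) (auto simp: \<phi>_def intro!: continuous_intros)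
      obtain n0 where n0: "\<And>n s. n0 \<le> n \<Longrightarrow> s \<in> {0..1} \<Longrightarrow>
          \<bar>(h \<circ> \<phi>) s - (\<Sum>k\<le>n. (h \<circ> \<phi>) (real k / real n) * Bernstein n k s)\<bar> < e / 2"
        using Bernstein_Weierstrass[OF c\<phi>, of "e / 2"] e by auto
      have "norm (integral\<^sup>L (\<mu> n) (\<lambda>z. h (clamp z)) - \<Lambda> h) < e" if n: "n0 \<le> n" for n
      proof -
        have "integral\<^sup>L (\<mu> n) (\<lambda>z. h (clamp z)) = (\<Sum>k\<le>n. h (node n k) * w n k)"
          by (subst integral_\<mu>[OF mH]) (auto simp: clamp_id[OF node] mult.commute intro!: sum.cong)
        also have "\<dots> = \<Lambda> (\<lambda>z. \<Sum>k\<le>n. h (node n k) * B n k z)"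
          by (subst sum) (auto simp: scale[OF B_cont] w_def intro!: continuous_intros B_cont)
        finally have eq: "integral\<^sup>L (\<mu> n) (\<lambda>z. h (clamp z)) = \<Lambda> (\<lambda>z. \<Sum>k\<le>n. h (node n k) * B n k z)" .
        have "\<bar>\<Lambda> (\<lambda>z. \<Sum>k\<le>n. h (node n k) * B n k z) - \<Lambda> h\<bar> \<le> e / 2"
        proof (rule near)
          fix z assume "z \<in> {a..b}"
          from n0[OF n \<psi>[OF this]] show "\<bar>(\<Sum>k\<le>n. h (node n k) * B n k z) - h z\<bar> \<le> e / 2"
            by (simp add: \<psi>\<phi> node_def B_def abs_minus_commute)
        qed (intro continuous_intros B_cont h)+
        then show ?thesis using e by (simp add: eq)
      qed
      then show "\<exists>n0. \<forall>n\<ge>n0. norm (integral\<^sup>L (\<mu> n) (\<lambda>z. h (clamp z)) - \<Lambda> h) < e" by blast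
    qed
    then have "(\<lambda>n. integral\<^sup>L (\<mu> (r n)) (\<lambda>z. h (clamp z))) \<longlonglongrightarrow> \<Lambda> h"
      using LIMSEQ_subseq_LIMSEQ[OF _ r] by (simp add: comp_def)
    ultimately show ?thesis by (rule LIMSEQ_unique)
  qed
  define \<nu> where "\<nu> = restrict_space N {a..b}"
  have "emeasure \<nu> (space \<nu>) = emeasure N {a..b}"
    by (simp add: \<nu>_def emeasure_restrict_space space_restrict_space)
  also have "\<dots> = 1" using conc by (simp add: N.emeasure_eq_1_AE)
  finally have "prob_space \<nu>" by (rule prob_spaceI)
  moreover have "sets \<nu> = sets (restrict_space borel {a..b})"
    by (simp add: \<nu>_def sets_restrict_space)
  moreover have "integral\<^sup>L \<nu> h = \<Lambda> h" if h: "continuous_on {a..b} h" for h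
  proof -
    have cH: "continuous_on UNIV (\<lambda>z. h (clamp z))"
      by (rule continuous_on_compose2[OF h clamp_cont]) (use clamp in auto)
    have [measurable]: "(\<lambda>z. h (clamp z)) \<in> borel_measurable borel"
      by (rule borel_measurable_continuous_onI[OF cH])
    have "integral\<^sup>L \<nu> h = integral\<^sup>L \<nu> (\<lambda>z. h (clamp z))"
      by (intro Bochner_Integration.integral_cong) (auto simp: \<nu>_def space_restrict_space clamp_id)
    also have "\<dots> = (LINT z|N. indicator {a..b} z *\<^sub>R h (clamp z))"
      unfolding \<nu>_def by (rule integral_restrict_space) simp
    also have "\<dots> = (LINT z|N. h (clamp z))"
    proof (rule integral_cong_AE)
      show "AE z in N. indicator {a..b} z *\<^sub>R h (clamp z) = h (clamp z)"
        using conc by eventually_elim simp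
    qed measurable
    finally show ?thesis by (simp add: integral_N[OF h])
  qed
  ultimately show ?thesis by blast
qed

text \<open>The relation \<open>rep p v\<close> describes a functional with values \<open>v\<close> on a space of functions \<open>p\<close>
  that are only determined on \<open>S\<close>. Positivity makes the intervals \<open>{v - e..v + e}\<close>, taken over all
  approximations of \<open>h\<close> within \<open>e\<close>, meet pairwise, so they have a common point.\<close>

lemma positive_functional_extension:
  fixes S :: "'a set" and rep :: "('a \<Rightarrow> real) \<Rightarrow> real \<Rightarrow> bool" and h :: "'a \<Rightarrow> real"
  assumes add: "\<And>p q v u. rep p v \<Longrightarrow> rep q u \<Longrightarrow> rep (\<lambda>z. p z + q z) (v + u)"
    and scale: "\<And>c p v. rep p v \<Longrightarrow> rep (\<lambda>z. c * p z) (c * v)"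
    and one: "rep (\<lambda>_. 1) 1"
    and pos: "\<And>p v. rep p v \<Longrightarrow> (\<And>z. z \<in> S \<Longrightarrow> 0 \<le> p z) \<Longrightarrow> 0 \<le> v"
  shows "\<exists>L. \<forall>p v e. rep p v \<longrightarrow> (\<forall>z\<in>S. \<bar>h z - p z\<bar> \<le> e) \<longrightarrow> \<bar>L - v\<bar> \<le> e"
proof -
  define A where "A = {v - e | p v e. rep p v \<and> (\<forall>z\<in>S. \<bar>h z - p z\<bar> \<le> e)}"
  have sep: "x \<le> v + e" if "x \<in> A" "rep p v" "\<forall>z\<in>S. \<bar>h z - p z\<bar> \<le> e" for x p v e
  proof -
    obtain q u d where q: "x = u - d" "rep q u" "\<forall>z\<in>S. \<bar>h z - q z\<bar> \<le> d"
      using \<open>x \<in> A\<close> unfolding A_def by blast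
    have "rep (\<lambda>z. p z + (- 1) * q z + (e + d) * 1) (v + (- 1) * u + (e + d) * 1)"
      by (intro add scale one that q)
    then have "0 \<le> v + (- 1) * u + (e + d) * 1"
      by (rule pos) (use that(3) q(3) in \<open>fastforce simp: abs_le_iff\<close>)
    then show ?thesis using q(1) by simp
  qed
  have "\<bar>Sup A - v\<bar> \<le> e" if "rep p v" "\<forall>z\<in>S. \<bar>h z - p z\<bar> \<le> e" for p v e
  proof -
    have "v - e \<in> A" using that unfolding A_def by blast
    then have "v - e \<le> Sup A" "Sup A \<le> v + e"
      using sep[OF _ that] by (auto intro!: cSup_upper cSup_least bdd_aboveI[of _ "v + e"])
    then show ?thesis by (simp add: abs_le_iff)
  qed
  then show ?thesis by blast
qed

text \<open>The values \<open>t i\<close> prescribe a positive functional on the span of the \<open>f i\<close>. Density makes its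
  extension to all continuous functions linear, and the extension is then an integral.\<close>

theorem moment_problem_Icc:
  fixes a b :: real and f :: "nat \<Rightarrow> real \<Rightarrow> real" and t :: "nat \<Rightarrow> real"
  assumes ab: "a < b"
    and f_zero: "\<And>z. z \<in> {a..b} \<Longrightarrow> f 0 z = 1" and t_zero: "t 0 = 1"
    and pos: "\<And>n d. (\<And>z. z \<in> {a..b} \<Longrightarrow> 0 \<le> (\<Sum>i<n. d i * f i z)) \<Longrightarrow> 0 \<le> (\<Sum>i<n. d i * t i)"
    and dense: "\<And>h e. continuous_on {a..b} h \<Longrightarrow> 0 < e \<Longrightarrow>
      \<exists>n d. \<forall>z\<in>{a..b}. \<bar>h z - (\<Sum>i<n. d i * f i z)\<bar> < e"
    and f_cont: "\<And>i. continuous_on {a..b} (f i)"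
  shows "\<exists>\<nu>. prob_space \<nu> \<and> sets \<nu> = sets (restrict_space borel {a..b}) \<and> (\<forall>i. integral\<^sup>L \<nu> (f i) = t i)"
proof -
  define rep where "rep p v \<longleftrightarrow>
    (\<exists>n d. (\<forall>z\<in>{a..b}. p z = (\<Sum>i<n. d i * f i z)) \<and> v = (\<Sum>i<n. d i * t i))" for p v
  have repI: "rep p (\<Sum>i<n. d i * t i)" if "\<And>z. z \<in> {a..b} \<Longrightarrow> p z = (\<Sum>i<n. d i * f i z)" for p n d
    unfolding rep_def using that by blast
  have rep_add: "rep (\<lambda>z. p z + q z) (v + u)" if "rep p v" "rep q u" for p q v u
  proof -
    obtain n d where p: "\<And>z. z \<in> {a..b} \<Longrightarrow> p z = (\<Sum>i<n. d i * f i z)" "v = (\<Sum>i<n. d i * t i)"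
      using \<open>rep p v\<close> unfolding rep_def by blast
    obtain m c where q: "\<And>z. z \<in> {a..b} \<Longrightarrow> q z = (\<Sum>i<m. c i * f i z)" "u = (\<Sum>i<m. c i * t i)"
      using \<open>rep q u\<close> unfolding rep_def by blast
    have pad: "(\<Sum>i<n. d i * g i) + (\<Sum>i<m. c i * g i)
      = (\<Sum>i<max n m. ((if i < n then d i else 0) + (if i < m then c i else 0)) * g i)" for g :: "nat \<Rightarrow> real"
    proof -
      have "(\<Sum>i<k. x i * g i) = (\<Sum>i<max n m. (if i < k then x i else 0) * g i)" if "k \<le> max n m" for k x
        using that by (intro sum.mono_neutral_cong_left) auto
      from this[of n d] this[of m c] show ?thesis by (simp add: sum.distrib algebra_simps)
    qed
    show ?thesis unfolding p(2) q(2) pad by (rule repI) (simp add: p(1) q(1) pad)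
  qed
  have rep_scale: "rep (\<lambda>z. c * p z) (c * v)" if "rep p v" for c p v
  proof -
    obtain n d where p: "\<And>z. z \<in> {a..b} \<Longrightarrow> p z = (\<Sum>i<n. d i * f i z)" "v = (\<Sum>i<n. d i * t i)"
      using \<open>rep p v\<close> unfolding rep_def by blast
    show ?thesis unfolding p(2) sum_distrib_left mult.assoc[symmetric]
      by (rule repI) (simp add: p(1) sum_distrib_left mult.assoc)
  qed
  have rep_one: "rep (\<lambda>_. 1) 1"
    using repI[where p = "\<lambda>_. 1" and n = 1 and d = "\<lambda>_. 1"] f_zero t_zero by simp
  have rep_pos: "0 \<le> v" if "rep p v" "\<And>z. z \<in> {a..b} \<Longrightarrow> 0 \<le> p z" for p v
    using that pos unfolding rep_def by auto
  have "\<exists>\<Lambda>. \<forall>h p v e. rep p v \<longrightarrow> (\<forall>z\<in>{a..b}. \<bar>h z - p z\<bar> \<le> e) \<longrightarrow> \<bar>\<Lambda> h - v\<bar> \<le> e"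
    using positive_functional_extension[of rep "{a..b}", OF rep_add rep_scale rep_one rep_pos]
    by (rule choice[OF allI])
  then obtain \<Lambda> where \<Lambda>: "\<And>h p v e. rep p v \<Longrightarrow> (\<And>z. z \<in> {a..b} \<Longrightarrow> \<bar>h z - p z\<bar> \<le> e) \<Longrightarrow> \<bar>\<Lambda> h - v\<bar> \<le> e"
    by blast
  have approx: "\<exists>p v. rep p v \<and> (\<forall>z\<in>{a..b}. \<bar>h z - p z\<bar> \<le> e)" if h: "continuous_on {a..b} h" "0 < e" for h e
  proof -
    obtain n d where "\<And>z. z \<in> {a..b} \<Longrightarrow> \<bar>h z - (\<Sum>i<n. d i * f i z)\<bar> < e"
      using dense[OF h] by blast
    then show ?thesis
      by (intro exI[of _ "\<lambda>z. \<Sum>i<n. d i * f i z"] exI[of _ "\<Sum>i<n. d i * t i"] conjI repI ballI)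
        (auto intro: less_imp_le)
  qed
  have \<Lambda>_rep: "\<Lambda> p = v" if "rep p v" for p v
    using \<Lambda>[OF that, of p 0] by simp
  have zero: "x = y" if "\<And>e. 0 < e \<Longrightarrow> \<bar>x - y\<bar> \<le> e" for x y :: real
  proof (rule ccontr)
    assume "x \<noteq> y"
    then show False using that[of "\<bar>x - y\<bar> / 2"] by simp
  qed
  obtain \<nu> where \<nu>: "prob_space \<nu>" "sets \<nu> = sets (restrict_space borel {a..b})"
    "\<And>h. continuous_on {a..b} h \<Longrightarrow> integral\<^sup>L \<nu> h = \<Lambda> h"
  proof -
    have "\<Lambda> (\<lambda>z. g z + h z) = \<Lambda> g + \<Lambda> h" if c: "continuous_on {a..b} g" "continuous_on {a..b} h" for g h
    proof (rule zero)
      fix e :: real assume "0 < e"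
      then have e: "0 < e / 4" by simp
      obtain p v q u where p: "rep p v" "\<forall>z\<in>{a..b}. \<bar>g z - p z\<bar> \<le> e / 4"
        and q: "rep q u" "\<forall>z\<in>{a..b}. \<bar>h z - q z\<bar> \<le> e / 4"
        using approx[OF c(1) e] approx[OF c(2) e] by blast
      have "\<bar>\<Lambda> g - v\<bar> \<le> e / 4" "\<bar>\<Lambda> h - u\<bar> \<le> e / 4" using \<Lambda> p q by blast+
      moreover have "\<bar>g z + h z - (p z + q z)\<bar> \<le> e / 2" if "z \<in> {a..b}" for z
        using bspec[OF p(2) that] bspec[OF q(2) that] by linarith
      then have "\<bar>\<Lambda> (\<lambda>z. g z + h z) - (v + u)\<bar> \<le> e / 2"
        by (rule \<Lambda>[OF rep_add[OF p(1) q(1)]])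
      ultimately show "\<bar>\<Lambda> (\<lambda>z. g z + h z) - (\<Lambda> g + \<Lambda> h)\<bar> \<le> e" by linarith
    qed
    moreover have "\<Lambda> (\<lambda>z. c * h z) = c * \<Lambda> h" if h: "continuous_on {a..b} h" for c h
    proof (rule zero)
      fix e :: real assume "0 < e"
      define d where "d = e / (2 * (\<bar>c\<bar> + 1))"
      have "0 < 2 * (\<bar>c\<bar> + 1)" by (simp add: add_nonneg_pos)
      then have "0 < d" "d * (2 * (\<bar>c\<bar> + 1)) = e"
        using \<open>0 < e\<close> by (simp_all add: d_def)
      then have d: "0 < d" "\<bar>c\<bar> * d + \<bar>c\<bar> * d \<le> e"
        by (simp_all add: algebra_simps)
      obtain p v where p: "rep p v" "\<forall>z\<in>{a..b}. \<bar>h z - p z\<bar> \<le> d"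
        using approx[OF h d(1)] by blast
      have mult: "\<bar>c * x - c * y\<bar> \<le> \<bar>c\<bar> * d" if "\<bar>x - y\<bar> \<le> d" for x y
        using mult_left_mono[OF that, of "\<bar>c\<bar>"] by (simp add: right_diff_distrib[symmetric] abs_mult)
      have "\<bar>\<Lambda> h - v\<bar> \<le> d" using \<Lambda> p by blast
      then have "\<bar>c * \<Lambda> h - c * v\<bar> \<le> \<bar>c\<bar> * d" by (rule mult)
      moreover have "\<bar>\<Lambda> (\<lambda>z. c * h z) - c * v\<bar> \<le> \<bar>c\<bar> * d"
        using p(2) by (intro \<Lambda>[OF rep_scale[OF p(1)]] mult) blast
      moreover note d(2)
      ultimately show "\<bar>\<Lambda> (\<lambda>z. c * h z) - c * \<Lambda> h\<bar> \<le> e" by linarith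
    qed
    moreover have "0 \<le> \<Lambda> h" if h: "continuous_on {a..b} h" "\<And>z. z \<in> {a..b} \<Longrightarrow> 0 \<le> h z" for h
    proof (rule field_le_epsilon)
      fix e :: real assume "0 < e"
      then have e: "0 < e / 2" by simp
      obtain p v where p: "rep p v" "\<forall>z\<in>{a..b}. \<bar>h z - p z\<bar> \<le> e / 2"
        using approx[OF h(1) e] by blast
      have "\<bar>\<Lambda> h - v\<bar> \<le> e / 2" using \<Lambda> p by blast
      moreover have "0 \<le> p z + e / 2 * 1" if "z \<in> {a..b}" for z
        using bspec[OF p(2) that] h(2)[OF that] by linarith
      then have "0 \<le> v + e / 2 * 1"
        by (rule rep_pos[OF rep_add[OF p(1) rep_scale[OF rep_one]]])
      ultimately show "0 \<le> \<Lambda> h + e" by linarith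
    qed
    ultimately show thesis
      using riesz_representation_Icc[OF ab, of \<Lambda>] \<Lambda>_rep[OF rep_one] that by blast
  qed
  have rep_f: "rep (f i) (t i)" for i
  proof -
    have "rep (f i) (\<Sum>j<Suc i. (if j = i then 1 else 0) * t j)" by (rule repI) simp
    then show ?thesis by simp
  qed
  then have "integral\<^sup>L \<nu> (f i) = t i" for i
    using \<nu>(3)[OF f_cont] \<Lambda>_rep by simp
  then show ?thesis using \<nu>(1,2) by blast
qed

section \<open>Measures on an interval and continuous functions\<close>

lemma sets_restrict_borel_Icc:
  "sets (restrict_space borel {a..b::real}) = sigma_sets {a..b} (range (\<lambda>c. {a..b} \<inter> {..c}))"
proof -
  have "sets (restrict_space borel {a..b}) = (\<inter>) {a..b} ` sigma_sets UNIV (range (\<lambda>c::real. {..c}))"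
    by (simp add: sets_restrict_space borel_eq_atMost)
  also have "\<dots> = sigma_sets {a..b} ((\<inter>) {a..b} ` range (\<lambda>c::real. {..c}))"
  proof (rule sigma_sets_Int)
    have "{a..b} \<in> sets (borel :: real measure)" by simp
    then show "{a..b} \<in> sigma_sets UNIV (range (\<lambda>c::real. {..c}))"
      unfolding borel_eq_atMost by simp
  qed simp
  finally show ?thesis by (simp add: image_image)
qed

lemma Int_stable_initial_segments: "Int_stable (range (\<lambda>c. {a..b::real} \<inter> {..c}))"
proof (rule Int_stableI_image)
  fix c d :: real
  have "{a..b} \<inter> {..c} \<inter> ({a..b} \<inter> {..d}) = {a..b} \<inter> {..min c d}" by auto
  then show "\<exists>e\<in>UNIV. {a..b} \<inter> {..c} \<inter> ({a..b} \<inter> {..d}) = {a..b} \<inter> {..e}" by blast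
qed

definition ramp :: "real \<Rightarrow> nat \<Rightarrow> real \<Rightarrow> real" where
  "ramp c n z = max 0 (1 - real n * max 0 (z - c))"

lemma continuous_ramp: "continuous_on S (ramp c n)"
  unfolding ramp_def by (intro continuous_intros)

lemma ramp_tendsto: "(\<lambda>n. ramp c n z) \<longlonglongrightarrow> indicator {..c} z"
proof (cases "z \<le> c")
  case True
  then show ?thesis by (simp add: ramp_def)
next
  case False
  obtain N :: nat where N: "1 / (z - c) \<le> real N" using real_arch_simple by blast
  have "ramp c n z = 0" if "N \<le> n" for n
  proof -
    have "1 \<le> real N * (z - c)" using N False by (simp add: field_simps)
    also have "\<dots> \<le> real n * (z - c)" using that False by (intro mult_right_mono) auto
    finally show ?thesis using False by (simp add: ramp_def)
  qed
  then have "eventually (\<lambda>n. ramp c n z = 0) sequentially"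
    unfolding eventually_sequentially by blast
  then show ?thesis using False by (simp add: tendsto_eventually)
qed

text \<open>Expresses the measure of an initial segment by integrals of continuous functions; from this
  come both the uniqueness of measures with given integrals and the measurability of kernels.\<close>

lemma measure_initial_segment_lim:
  assumes "prob_space \<nu>" and sets: "sets \<nu> = sets (restrict_space borel {a..b})"
  shows "(\<lambda>n. integral\<^sup>L \<nu> (ramp c n)) \<longlonglongrightarrow> measure \<nu> ({a..b} \<inter> {..c})"
proof -
  interpret prob_space \<nu> by fact
  have space: "space \<nu> = {a..b}" using sets_eq_imp_space_eq[OF sets] by (simp add: space_restrict_space)
  have A: "{a..b} \<inter> {..c} \<in> sets \<nu>" unfolding sets sets_restrict_space by (intro imageI) simp
  have [measurable]: "ramp c n \<in> borel_measurable \<nu>" for n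
    using borel_measurable_continuous_on_restrict[OF continuous_ramp]
    by (simp add: measurable_cong_sets[OF sets refl])
  have "(\<lambda>n. integral\<^sup>L \<nu> (ramp c n)) \<longlonglongrightarrow> integral\<^sup>L \<nu> (indicator ({a..b} \<inter> {..c}))"
  proof (rule integral_dominated_convergence[where w = "\<lambda>_. 1"])
    show "AE z in \<nu>. (\<lambda>n. ramp c n z) \<longlonglongrightarrow> indicator ({a..b} \<inter> {..c}) z"
    proof (rule AE_I2)
      fix z assume "z \<in> space \<nu>"
      then have "indicator ({a..b} \<inter> {..c}) z = (indicator {..c} z :: real)"
        by (simp only: space indicator_inter_arith) simp
      then show "(\<lambda>n. ramp c n z) \<longlonglongrightarrow> indicator ({a..b} \<inter> {..c}) z"
        using ramp_tendsto[of c z] by simp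
    qed
    show "AE z in \<nu>. norm (ramp c n z) \<le> 1" for n by (rule AE_I2) (simp add: ramp_def)
  qed (use A in auto)
  then show ?thesis using A by simp
qed

lemma measure_eqI_continuous:
  assumes P: "prob_space \<nu>" "prob_space \<nu>'"
    and sets: "sets \<nu> = sets (restrict_space borel {a..b})" "sets \<nu>' = sets (restrict_space borel {a..b})"
    and eq: "\<And>h::real \<Rightarrow> real. continuous_on {a..b} h \<Longrightarrow> integral\<^sup>L \<nu> h = integral\<^sup>L \<nu>' h"
  shows "\<nu> = \<nu>'"
proof -
  interpret n: prob_space \<nu> by fact
  interpret n': prob_space \<nu>' by fact
  have "measure \<nu> ({a..b} \<inter> {..c}) = measure \<nu>' ({a..b} \<inter> {..c})" for c
    using measure_initial_segment_lim[OF P(1) sets(1), of c] measure_initial_segment_lim[OF P(2) sets(2), of c]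
    by (simp add: eq[OF continuous_ramp] LIMSEQ_unique)
  then have m: "emeasure \<nu> ({a..b} \<inter> {..c}) = emeasure \<nu>' ({a..b} \<inter> {..c})" for c
    by (simp add: n.emeasure_eq_measure n'.emeasure_eq_measure)
  show ?thesis
  proof (rule measure_eqI_generator_eq[OF Int_stable_initial_segments])
    show "range (\<lambda>c. {a..b} \<inter> {..c}) \<subseteq> Pow {a..b}" by auto
    show "range (\<lambda>_::nat. {a..b} \<inter> {..b}) \<subseteq> range (\<lambda>c. {a..b} \<inter> {..c})" by auto
    show "(\<Union>i::nat. {a..b} \<inter> {..b}) = {a..b}" by auto
    show "emeasure \<nu> ({a..b} \<inter> {..b}) \<noteq> \<infinity>" by simp
    show "emeasure \<nu> A = emeasure \<nu>' A" if "A \<in> range (\<lambda>c. {a..b} \<inter> {..c})" for A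
      using that m by blast
  qed (simp_all only: sets sets_restrict_borel_Icc)
qed

section \<open>Neumann eigenfunctions\<close>

locale neumann_spectrum =
  fixes a b :: real and \<rho> :: "real \<Rightarrow> real" and F :: "nat \<Rightarrow> real \<Rightarrow> real" and l :: "nat \<Rightarrow> real"
  assumes admissible: "admissible_density a b \<rho>"
    and onb: "L2_orthonormal_basis (density_measure a b \<rho>) F"
    and F_zero: "\<And>x. x \<in> {a..b} \<Longrightarrow> F 0 x = 1"
    and F_pos: "\<And>i. F i a > 0"
    and l_zero: "l 0 = 0"
    and l_strict_mono: "strict_mono l"
    and eigen: "\<And>i. neumann_eigenfunction a b \<rho> (l i) (F i)"
begin

definition flux :: "nat \<Rightarrow> real \<Rightarrow> real" where
  "flux i x = \<rho> x * deriv_on a b (F i) x"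

lemma a_less_b: "a < b"
  using admissible by (simp add: admissible_density_def)

lemma rho_pos: "x \<in> {a..b} \<Longrightarrow> \<rho> x > 0"
  using admissible unfolding admissible_density_def by (meson less_le_trans)

lemma DERIV_deriv_on:
  assumes "f differentiable_on {a..b}" "x \<in> {a..b}"
  shows "(f has_real_derivative deriv_on a b f x) (at x within {a..b})"
  using assms unfolding deriv_on_def differentiable_on_def has_real_derivative_iff_has_vector_derivative
  by (simp add: vector_derivative_works[symmetric])

lemma DERIV_rho:
  "x \<in> {a..b} \<Longrightarrow> (\<rho> has_real_derivative deriv_on a b \<rho> x) (at x within {a..b})"
  using admissible unfolding admissible_density_def smooth_on_interval_def
  by (intro DERIV_deriv_on) (metis funpow_0)+

lemma DERIV_F:
  "x \<in> {a..b} \<Longrightarrow> (F i has_real_derivative deriv_on a b (F i) x) (at x within {a..b})"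
  using eigen[of i] unfolding neumann_eigenfunction_def by (intro DERIV_deriv_on) auto

text \<open>The eigenvalue equation in divergence form, \<open>(\<rho> F')' = - l \<rho> F\<close>.\<close>

lemma DERIV_flux:
  assumes x: "x \<in> {a..b}"
  shows "(flux i has_real_derivative - l i * (\<rho> x * F i x)) (at x within {a..b})"
proof -
  let ?f' = "deriv_on a b (F i)"
  have "(flux i has_real_derivative deriv_on a b \<rho> x * ?f' x + deriv_on a b ?f' x * \<rho> x)
    (at x within {a..b})"
    unfolding flux_def using eigen[of i] x
    by (intro DERIV_mult DERIV_rho DERIV_deriv_on) (auto simp: neumann_eigenfunction_def)
  moreover have "deriv_on a b ?f' x + deriv_on a b \<rho> x / \<rho> x * ?f' x = - l i * F i x"
    using eigen[of i] x unfolding neumann_eigenfunction_def diffusion_op_def by blast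
  then have "deriv_on a b \<rho> x * ?f' x + deriv_on a b ?f' x * \<rho> x = - l i * (\<rho> x * F i x)"
    using rho_pos[OF x] by (simp add: field_simps)
  ultimately show ?thesis by simp
qed

lemma flux_boundary [simp]: "flux i a = 0" "flux i b = 0"
  using eigen[of i] by (auto simp: flux_def neumann_eigenfunction_def)

lemma DERIV_const_on_zero:
  assumes x: "x \<in> {a..b}" and D: "(f has_real_derivative D) (at x within {a..b})"
    and const: "\<And>y. y \<in> {a..b} \<Longrightarrow> f y = c"
  shows "D = 0"
proof -
  have "((\<lambda>_. c) has_real_derivative D) (at x within {a..b})"
    by (rule has_field_derivative_transform_within[OF D zero_less_one x]) (simp add: const)
  moreover have "((\<lambda>_. c) has_real_derivative 0) (at x within {a..b})" by simp
  ultimately show ?thesis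
    unfolding has_real_derivative_iff_has_vector_derivative
    by (intro vector_derivative_unique_within_closed_interval[of a b x "\<lambda>_. c"])
      (use x a_less_b in \<open>auto simp: cbox_interval\<close>)
qed

lemma flux_zero: "x \<in> {a..b} \<Longrightarrow> flux 0 x = 0"
  using DERIV_const_on_zero[OF _ DERIV_F[of x 0] F_zero] by (simp add: flux_def)

lemma l_pos: "i > 0 \<Longrightarrow> l i > 0"
  using strict_monoD[OF l_strict_mono, of 0 i] l_zero by simp

lemma continuous_rho: "continuous_on {a..b} \<rho>"
  by (rule DERIV_continuous_on[OF DERIV_rho])

lemma continuous_F: "continuous_on {a..b} (F i)"
  by (rule DERIV_continuous_on[OF DERIV_F])

lemma continuous_flux: "continuous_on {a..b} (flux i)"
  by (rule DERIV_continuous_on[OF DERIV_flux])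

lemma DERIV_interior:
  "(f has_real_derivative D) (at x within {a..b}) \<Longrightarrow> x \<in> {a<..<b} \<Longrightarrow> DERIV f x :> D"
  by (simp add: at_within_Icc_at)

section \<open>Positivity for the two-variable equation\<close>

definition log_deriv :: "real \<Rightarrow> real" where
  "log_deriv x = deriv_on a b \<rho> x / \<rho> x"

text \<open>The solution of the two-variable equation. The constant \<open>e\<close> serves to make nonnegative
  data strictly positive.\<close>

definition wave :: "real \<Rightarrow> (nat \<Rightarrow> real) \<Rightarrow> nat \<Rightarrow> real \<Rightarrow> real \<Rightarrow> real" where
  "wave e d n x y = e + (\<Sum>i<n. d i * F i x * F i y)"

text \<open>The conjugate function \<open>v\<close> of \<open>wave\<close>: since \<open>(flux i)' = - l i * \<rho> * F i\<close>, it satisfies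
  \<open>v\<^sub>x = R u\<^sub>y\<close> and \<open>v\<^sub>y = R u\<^sub>x\<close> for \<open>R = \<rho> x * \<rho> y\<close>. The term \<open>i = 0\<close> is \<open>0\<close>, because division by
  \<open>l 0 = 0\<close> gives \<open>0\<close>; this is the right value, as a constant has no flux.\<close>

definition conj_wave :: "(nat \<Rightarrow> real) \<Rightarrow> nat \<Rightarrow> real \<Rightarrow> real \<Rightarrow> real" where
  "conj_wave d n x y = (\<Sum>i<n. - d i / l i * flux i x * flux i y)"

text \<open>On the line \<open>x = q + s t\<close>, \<open>y = t\<close> the derivative of \<open>u\<close> is \<open>s u\<^sub>x + u\<^sub>y\<close> and that of \<open>s v\<close>
  is \<open>s (s R u\<^sub>y + R u\<^sub>x) = R (u\<^sub>y + s u\<^sub>x)\<close>. So only the derivative of the weight \<open>R\<close> remains.\<close>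

lemma DERIV_characteristic:
  assumes s: "s * s = 1" and t: "t \<in> {a<..<b}" and x: "q + s * t \<in> {a<..<b}"
  shows "DERIV (\<lambda>t. \<rho> (q + s * t) * \<rho> t * wave e d n (q + s * t) t - s * conj_wave d n (q + s * t) t) t
    :> \<rho> (q + s * t) * \<rho> t * wave e d n (q + s * t) t * (s * log_deriv (q + s * t) + log_deriv t)"
proof -
  let ?x = "\<lambda>t. q + s * t"
  have path: "DERIV ?x t :> s" by (auto intro!: derivative_eq_intros)
  have comp: "DERIV (\<lambda>t. f (?x t)) t :> D * s" if "(f has_real_derivative D) (at (?x t) within {a..b})" for f D
    using DERIV_chain2[OF DERIV_interior[OF that x] path] .
  have plain: "DERIV f t :> D" if "(f has_real_derivative D) (at t within {a..b})" for f D
    using DERIV_interior[OF that t] .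
  have x': "?x t \<in> {a..b}" and t': "t \<in> {a..b}" using x t by auto
  let ?r = "deriv_on a b \<rho>" and ?f = "\<lambda>i. deriv_on a b (F i)"
  note cF = comp[OF DERIV_F[OF x']] and pF = plain[OF DERIV_F[OF t']]
    and cW = comp[OF DERIV_flux[OF x']] and pW = plain[OF DERIV_flux[OF t']]
  have dU: "DERIV (\<lambda>t. wave e d n (?x t) t) t
    :> (\<Sum>i<n. d i * (?f i (?x t) * s * F i t + ?f i t * F i (?x t)))"
    unfolding wave_def mult.assoc[of "d _"]
    using DERIV_add[OF DERIV_const[of e] DERIV_sum[OF DERIV_cmult[OF DERIV_mult[OF cF pF]]]]
    by simp
  have dV: "DERIV (\<lambda>t. conj_wave d n (?x t) t) t
    :> (\<Sum>i<n. - d i / l i * (- l i * (\<rho> (?x t) * F i (?x t)) * s * flux i t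
          + - l i * (\<rho> t * F i t) * flux i (?x t)))"
    unfolding conj_wave_def mult.assoc[of "- d _ / l _"]
    by (intro DERIV_sum DERIV_cmult DERIV_mult cW pW)
  have V_eq: "s * (\<Sum>i<n. - d i / l i * (- l i * (\<rho> (?x t) * F i (?x t)) * s * flux i t
          + - l i * (\<rho> t * F i t) * flux i (?x t)))
     = \<rho> (?x t) * \<rho> t * (\<Sum>i<n. d i * (?f i (?x t) * s * F i t + ?f i t * F i (?x t)))"
    unfolding sum_distrib_left
  proof (rule sum.cong[OF refl])
    fix i
    show "s * (- d i / l i * (- l i * (\<rho> (?x t) * F i (?x t)) * s * flux i t
          + - l i * (\<rho> t * F i t) * flux i (?x t)))
     = \<rho> (?x t) * \<rho> t * (d i * (?f i (?x t) * s * F i t + ?f i t * F i (?x t)))"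
    proof (cases "i = 0")
      case True
      then have "?f i t = 0" "?f i (?x t) = 0"
        using flux_zero[OF t'] flux_zero[OF x'] rho_pos[OF t'] rho_pos[OF x'] by (auto simp: flux_def)
      then show ?thesis using True by (simp add: l_zero)
    next
      case False
      have "s * (- d i / l i * (- l i * (\<rho> (?x t) * F i (?x t)) * s * flux i t
          + - l i * (\<rho> t * F i t) * flux i (?x t)))
        = d i * ((s * s) * (\<rho> (?x t) * F i (?x t)) * flux i t + s * flux i (?x t) * (\<rho> t * F i t))"
        using l_pos[of i] False by (simp add: field_simps)
      then show ?thesis unfolding s flux_def by (simp add: algebra_simps)
    qed
  qed
  have "DERIV (\<lambda>t. \<rho> (?x t) * \<rho> t * wave e d n (?x t) t - s * conj_wave d n (?x t) t) t
    :> (?r (?x t) * s * \<rho> t + ?r t * \<rho> (?x t)) * wave e d n (?x t) t"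
    using DERIV_diff[OF DERIV_mult[OF DERIV_mult[OF comp[OF DERIV_rho[OF x']] plain[OF DERIV_rho[OF t']]] dU]
        DERIV_cmult[OF dV, of s]]
    by (simp only: V_eq) (simp add: algebra_simps)
  moreover have "(?r (?x t) * s * \<rho> t + ?r t * \<rho> (?x t)) * wave e d n (?x t) t
    = \<rho> (?x t) * \<rho> t * wave e d n (?x t) t * (s * log_deriv (?x t) + log_deriv t)"
    using rho_pos[OF t'] rho_pos[OF x'] by (simp add: log_deriv_def field_simps)
  ultimately show ?thesis by simp
qed

lemma continuous_characteristic:
  assumes "{y1..y0} \<subseteq> {a..b}" and "(\<lambda>t. q + s * t) ` {y1..y0} \<subseteq> {a..b}"
  shows "continuous_on {y1..y0}
    (\<lambda>t. \<rho> (q + s * t) * \<rho> t * wave e d n (q + s * t) t - s * conj_wave d n (q + s * t) t)"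
proof -
  have comp: "continuous_on {y1..y0} (\<lambda>t. f (q + s * t))" "continuous_on {y1..y0} f"
    if "continuous_on {a..b} f" for f :: "real \<Rightarrow> real"
  proof -
    show "continuous_on {y1..y0} (\<lambda>t. f (q + s * t))"
      using assms(2) by (rule continuous_on_compose2[OF that, rotated]) (intro continuous_intros)
    show "continuous_on {y1..y0} f" using that assms(1) by (rule continuous_on_subset)
  qed
  show ?thesis
    unfolding wave_def conj_wave_def
    using comp[OF continuous_rho] comp[OF continuous_F] comp[OF continuous_flux]
    by (intro continuous_on_add continuous_on_diff continuous_on_mult continuous_on_sum
        continuous_on_const) auto
qed

lemma characteristic_increasing:
  assumes s: "s * s = 1" and y: "a \<le> y1" "y1 \<le> y0" "y0 \<le> b"
    and x: "\<And>t. y1 < t \<Longrightarrow> t < y0 \<Longrightarrow> q + s * t \<in> {a<..<b}"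
    and ends: "q + s * y1 \<in> {a..b}" "q + s * y0 \<in> {a..b}"
    and sgn: "\<And>t. y1 < t \<Longrightarrow> t < y0 \<Longrightarrow>
      wave e d n (q + s * t) t \<ge> 0 \<and> s * log_deriv (q + s * t) + log_deriv t \<ge> 0"
  shows "\<rho> (q + s * y1) * \<rho> y1 * wave e d n (q + s * y1) y1 - s * conj_wave d n (q + s * y1) y1
    \<le> \<rho> (q + s * y0) * \<rho> y0 * wave e d n (q + s * y0) y0 - s * conj_wave d n (q + s * y0) y0"
proof (rule DERIV_nonneg_imp_increasing_open[OF y(2)])
  fix t assume t: "y1 < t" "t < y0"
  then have xt: "q + s * t \<in> {a<..<b}" "t \<in> {a<..<b}" using x y by auto
  then have "\<rho> (q + s * t) > 0" "\<rho> t > 0" by (auto intro!: rho_pos)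
  then show "\<exists>D. DERIV (\<lambda>t. \<rho> (q + s * t) * \<rho> t * wave e d n (q + s * t) t - s * conj_wave d n (q + s * t) t) t
    :> D \<and> 0 \<le> D"
    using sgn[OF t] DERIV_characteristic[OF s xt(2,1), of e d n] by (intro exI conjI) auto
next
  have "q + s * t \<in> {a..b}" if "t \<in> {y1..y0}" for t
    using x[of t] ends that by (cases "t = y1 \<or> t = y0") (auto simp: less_le)
  then show "continuous_on {y1..y0}
    (\<lambda>t. \<rho> (q + s * t) * \<rho> t * wave e d n (q + s * t) t - s * conj_wave d n (q + s * t) t)"
    using y by (intro continuous_characteristic) auto
qed

lemma conj_wave_boundary [simp]:
  "conj_wave d n x a = 0" "conj_wave d n b y = 0"
  by (simp_all add: conj_wave_def)

text \<open>The maximum principle. The region \<open>a \<le> y \<le> x \<le> b\<close>, \<open>x + y \<le> c\<close> contains, with each of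
  its points, the two characteristics that descend from it to the boundary. The parameter \<open>c\<close>
  covers both applications: \<open>c = 2 * b\<close> imposes no restriction, and \<open>c = 0\<close> cuts out the lower quarter
  of a square centred at the origin.\<close>

lemma wave_positive:
  assumes dec: "\<And>x y. a < y \<Longrightarrow> y \<le> x \<Longrightarrow> x < b \<Longrightarrow> log_deriv x \<le> log_deriv y"
    and nonneg: "\<And>x y. a < y \<Longrightarrow> y \<le> x \<Longrightarrow> x < b \<Longrightarrow> x + y \<le> c \<Longrightarrow> 0 \<le> log_deriv x + log_deriv y"
    and base: "\<And>x. x \<in> {a..b} \<Longrightarrow> wave e d n x a > 0"
    and xy: "a \<le> y" "y \<le> x" "x \<le> b" "x + y \<le> c"
  shows "wave e d n x y > 0"
proof (rule ccontr)
  define D where "D = {z. a \<le> snd z \<and> snd z \<le> fst z \<and> fst z \<le> b \<and> fst z + snd z \<le> c}"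
  define Z where "Z = D \<inter> (\<lambda>z. wave e d n (fst z) (snd z)) -` {..0}"
  assume "\<not> wave e d n x y > 0"
  then have "(x, y) \<in> Z" using xy by (auto simp: Z_def D_def)
  have "D \<subseteq> {a..b} \<times> {a..b}" by (auto simp: D_def)
  then have "bounded D" by (rule bounded_subset[rotated]) (intro bounded_Times bounded_closed_interval)
  moreover have "closed D" unfolding D_def
    by (intro closed_Collect_conj closed_Collect_le continuous_intros)
  moreover have "continuous_on D (\<lambda>z. wave e d n (fst z) (snd z))"
    unfolding wave_def
    by (intro continuous_intros continuous_on_compose2[OF continuous_F]) (auto simp: D_def)
  ultimately have "closed Z" "bounded Z"
    unfolding Z_def by (auto intro: continuous_closed_preimage bounded_subset)
  then have "compact Z" by (simp add: compact_eq_bounded_closed)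
  then obtain z0 where z0: "z0 \<in> Z" "\<And>z. z \<in> Z \<Longrightarrow> snd z0 \<le> snd z"
    using continuous_attains_inf[of Z snd] \<open>(x, y) \<in> Z\<close> continuous_on_snd[OF continuous_on_id]
    by blast
  obtain x0 y0 where z0_eq: "z0 = (x0, y0)" by (cases z0)
  have D0: "a \<le> y0" "y0 \<le> x0" "x0 \<le> b" "x0 + y0 \<le> c" and U0: "wave e d n x0 y0 \<le> 0"
    using z0(1) by (auto simp: z0_eq Z_def D_def)
  have "y0 \<noteq> a" using base[of x0] U0 D0 by auto
  then have ay0: "a < y0" using D0 by simp
  have before: "wave e d n x y > 0" if "a \<le> y" "y \<le> x" "x \<le> b" "x + y \<le> c" "y < y0" for x y
    using z0(2)[of "(x, y)"] that by (force simp: Z_def D_def z0_eq)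
  \<comment> \<open>The characteristic with \<open>s = 1\<close> keeps \<open>x - y\<close> and ends on the side \<open>y = a\<close>.\<close>
  have "\<rho> (x0 - y0 + a) * \<rho> a * wave e d n (x0 - y0 + a) a
      \<le> \<rho> x0 * \<rho> y0 * wave e d n x0 y0 - conj_wave d n x0 y0"
    using characteristic_increasing[of 1 a y0 "x0 - y0" e d n] D0 ay0
      less_imp_le[OF before] nonneg by auto
  moreover have "\<rho> (x0 - y0 + a) * \<rho> a * wave e d n (x0 - y0 + a) a > 0"
    using before[of a "x0 - y0 + a"] D0 ay0 rho_pos by auto
  ultimately have left: "0 < \<rho> x0 * \<rho> y0 * wave e d n x0 y0 - conj_wave d n x0 y0" by simp
  have "0 \<le> \<rho> x0 * \<rho> y0" using D0 rho_pos[of x0] rho_pos[of y0] by auto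
  then have RU: "\<rho> x0 * \<rho> y0 * wave e d n x0 y0 \<le> 0" using U0 by (rule mult_nonneg_nonpos)
  \<comment> \<open>On the side \<open>x = b\<close> the conjugate function vanishes at the point itself.\<close>
  show False
  proof (cases "x0 = b")
    case True
    then show False using left RU by simp
  next
    case False
    \<comment> \<open>The one with \<open>s = -1\<close> keeps \<open>x + y\<close> and ends on \<open>y = a\<close> or on \<open>x = b\<close>, whichever it meets first.\<close>
    define y1 where "y1 = max a (x0 + y0 - b)"
    have y1: "a \<le> y1" "y1 < y0" "x0 + y0 - b \<le> y1" using False D0 ay0 by (auto simp: y1_def)
    have V1: "conj_wave d n (x0 + y0 - y1) y1 = 0"
      by (cases "y1 = a") (auto simp: y1_def max_def split: if_splits)
    have "\<rho> (x0 + y0 - y1) * \<rho> y1 * wave e d n (x0 + y0 - y1) y1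
      \<le> \<rho> x0 * \<rho> y0 * wave e d n x0 y0 + conj_wave d n x0 y0"
      using characteristic_increasing[of "-1" y1 y0 "x0 + y0" e d n] D0 ay0 y1 V1
        less_imp_le[OF before] dec by auto
    moreover have "\<rho> (x0 + y0 - y1) * \<rho> y1 * wave e d n (x0 + y0 - y1) y1 > 0"
      using before[of y1 "x0 + y0 - y1"] D0 y1 by (auto intro!: mult_pos_pos rho_pos)
    ultimately have "0 < \<rho> x0 * \<rho> y0 * wave e d n x0 y0" using left by simp
    then show False using RU by simp
  qed
qed


lemma wave_nonneg:
  assumes dec: "\<And>x y. a < y \<Longrightarrow> y \<le> x \<Longrightarrow> x < b \<Longrightarrow> log_deriv x \<le> log_deriv y"
    and nonneg: "\<And>x y. a < y \<Longrightarrow> y \<le> x \<Longrightarrow> x < b \<Longrightarrow> x + y \<le> c \<Longrightarrow> 0 \<le> log_deriv x + log_deriv y"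
    and base: "\<And>z. z \<in> {a..b} \<Longrightarrow> 0 \<le> (\<Sum>i<n. d i * F i z)"
    and xy: "a \<le> y" "y \<le> x" "x \<le> b" "x + y \<le> c"
  shows "0 \<le> (\<Sum>i<n. d i * (F i x * F i y / F i a))"
proof (rule field_le_epsilon)
  fix e :: real assume e: "0 < e"
  have "F i a \<noteq> 0" for i using F_pos[of i] by simp
  then have "wave e (\<lambda>i. d i / F i a) n z a = e + (\<Sum>i<n. d i * F i z)" for z
    by (simp add: wave_def)
  then have "0 < wave e (\<lambda>i. d i / F i a) n x y"
    using base e by (intro wave_positive[OF dec nonneg _ xy]) (auto simp: add_pos_nonneg)
  then show "0 \<le> (\<Sum>i<n. d i * (F i x * F i y / F i a)) + e"
    by (simp add: wave_def mult.assoc)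
qed

text \<open>Add the tangent inequalities for \<open>- ln \<rho>\<close> at \<open>x\<close> and at \<open>y\<close>.\<close>

lemma log_deriv_antimono:
  assumes lc: "log_concave_on {a..b} \<rho>" and xy: "a < y" "y \<le> x" "x < b"
  shows "log_deriv x \<le> log_deriv y"
proof (cases "x = y")
  case False
  have d: "((\<lambda>x. - ln (\<rho> x)) has_real_derivative - log_deriv z) (at z within {a..b})"
    if "z \<in> {a..b}" for z
    using rho_pos[OF that] unfolding log_deriv_def
    by (auto intro!: derivative_eq_intros DERIV_rho[OF that])
  have c: "convex_on {a..b} (\<lambda>x. - ln (\<rho> x))"
    using lc by (simp add: log_concave_on_def concave_on_def)
  have i: "x \<in> interior {a..b}" "y \<in> interior {a..b}" and m: "x \<in> {a..b}" "y \<in> {a..b}"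
    using xy by auto
  have "- log_deriv x * (y - x) \<le> - ln (\<rho> y) - - ln (\<rho> x)"
    by (rule convex_on_imp_above_tangent[OF c _ i(1) m(2) d[OF m(1)]]) simp
  moreover have "- log_deriv y * (x - y) \<le> - ln (\<rho> x) - - ln (\<rho> y)"
    by (rule convex_on_imp_above_tangent[OF c _ i(2) m(1) d[OF m(2)]]) simp
  ultimately have "(log_deriv x - log_deriv y) * (x - y) \<le> 0"
    by (simp add: algebra_simps)
  then show ?thesis using False xy by (auto simp: mult_le_0_iff)
qed simp

section \<open>Integration against the density\<close>

abbreviation \<mu> :: "real measure" where "\<mu> \<equiv> density_measure a b \<rho>"

abbreviation coef :: "(real \<Rightarrow> real) \<Rightarrow> nat \<Rightarrow> real" where
  "coef g i \<equiv> L2_inner \<mu> g (F i)"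

sublocale mu: prob_space \<mu>
  using admissible by (simp add: admissible_density_def)

lemma space_mu: "space \<mu> = {a..b}"
  by (simp add: density_measure_def space_restrict_space)

lemma sets_mu: "sets \<mu> = sets (restrict_space borel {a..b})"
  by (simp add: density_measure_def sets_restrict_space)

lemma measurable_continuous: "continuous_on {a..b} h \<Longrightarrow> h \<in> borel_measurable \<mu>"
  for h :: "real \<Rightarrow> real"
  using borel_measurable_continuous_on_restrict[of "{a..b}" h]
  by (simp add: measurable_cong_sets[OF sets_mu refl])

lemma integrable_of_continuous:
  fixes h :: "real \<Rightarrow> real"
  assumes "prob_space \<nu>" and sets: "sets \<nu> = sets \<mu>" and h: "continuous_on {a..b} h"
  shows "integrable \<nu> h"
proof -
  interpret prob_space \<nu> by fact
  obtain B where B: "\<And>x. x \<in> {a..b} \<Longrightarrow> norm (h x) \<le> B"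
    using compact_imp_bounded[OF compact_continuous_image[OF h compact_Icc]]
    unfolding bounded_iff by blast
  show ?thesis
  proof (rule integrable_const_bound[of _ B])
    show "AE x in \<nu>. norm (h x) \<le> B"
      using B by (intro AE_I2) (simp add: sets_eq_imp_space_eq[OF sets] space_mu)
    show "h \<in> borel_measurable \<nu>"
      using measurable_continuous[OF h] by (simp add: measurable_cong_sets[OF sets refl])
  qed
qed

lemma integrable_continuous: "continuous_on {a..b} h \<Longrightarrow> integrable \<mu> h" for h :: "real \<Rightarrow> real"
  by (rule integrable_of_continuous[OF mu.prob_space_axioms refl])

lemma integral_mu:
  fixes h :: "real \<Rightarrow> real"
  assumes "h \<in> borel_measurable \<mu>"
  shows "integral\<^sup>L \<mu> h = (LINT x|lborel. indicator {a..b} x *\<^sub>R (\<rho> x * h x))"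
proof -
  have s: "sets \<mu> = sets (restrict_space lborel {a..b})"
    by (simp add: density_measure_def)
  have "AE x in restrict_space lborel {a..b}. 0 \<le> \<rho> x"
    using rho_pos by (intro AE_I2) (auto simp: space_restrict_space intro: less_imp_le)
  then have "integral\<^sup>L \<mu> h = (LINT x|restrict_space lborel {a..b}. \<rho> x *\<^sub>R h x)"
    unfolding density_measure_def
    using assms measurable_continuous[OF continuous_rho]
    by (intro integral_density) (simp_all add: measurable_cong_sets[OF s refl])
  then show ?thesis by (simp add: integral_restrict_space)
qed

lemma inner_F_zero: "L2_inner \<mu> f (F 0) = integral\<^sup>L \<mu> f"
  unfolding L2_inner_def by (intro Bochner_Integration.integral_cong) (auto simp: space_mu F_zero)

lemma integral_F: "integral\<^sup>L \<mu> (F i) = (if i = 0 then 1 else 0)"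
  using onb unfolding inner_F_zero[symmetric] L2_orthonormal_basis_def by blast

lemma FTC_mu:
  assumes h: "continuous_on {a..b} h"
    and G: "\<And>x. x \<in> {a..b} \<Longrightarrow> (G has_real_derivative \<rho> x * h x) (at x within {a..b})"
    and z: "z \<in> {a..b}"
  shows "(LINT x|\<mu>. indicator {a..z} x * h x) = G z - G a"
proof -
  have [measurable]: "{a..z} \<in> sets \<mu>"
    using z by (auto simp: sets_mu sets_restrict_space intro!: image_eqI[of _ _ "{a..z}"])
  have [measurable]: "h \<in> borel_measurable \<mu>" by (rule measurable_continuous[OF h])
  have sub: "{a..z} \<subseteq> {a..b}" using z by auto
  have "(LINT x|\<mu>. indicator {a..z} x * h x)
    = (LINT x|lborel. indicator {a..b} x *\<^sub>R (\<rho> x * (indicator {a..z} x * h x)))"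
    by (rule integral_mu) measurable
  also have "\<dots> = (LINT x|lborel. indicator {a..z} x *\<^sub>R (\<rho> x * h x))"
    using sub by (intro Bochner_Integration.integral_cong) (auto simp: indicator_def)
  also have "\<dots> = G z - G a"
  proof (rule integral_FTC_atLeastAtMost)
    show "a \<le> z" using z by simp
    show "(G has_vector_derivative \<rho> x * h x) (at x within {a..z})" if "a \<le> x" "x \<le> z" for x
      using has_vector_derivative_within_subset[OF _ sub] G[of x] that z
      by (auto simp: has_real_derivative_iff_has_vector_derivative)
    show "continuous_on {a..z} (\<lambda>x. \<rho> x * h x)"
      by (intro continuous_on_subset[OF _ sub] continuous_intros continuous_rho h)
  qed
  finally show ?thesis .
qed

text \<open>A function \<open>G\<close> with \<open>G a = 0\<close> and \<open>G' = \<rho> h\<close> is bounded by the \<open>L\<^sup>1\<close> norm of \<open>h\<close> with respect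
  to \<open>\<mu>\<close>, hence by its \<open>L\<^sup>2\<close> norm. This turns \<open>L\<^sup>2\<close> convergence of
  expansions into uniform estimates.\<close>

lemma FTC_mu_bound:
  assumes h: "continuous_on {a..b} h"
    and G: "\<And>x. x \<in> {a..b} \<Longrightarrow> (G has_real_derivative \<rho> x * h x) (at x within {a..b})"
    and "G a = 0" and z: "z \<in> {a..b}"
  shows "\<bar>G z\<bar> \<le> L2_norm \<mu> h"
proof -
  have [measurable]: "{a..z} \<in> sets \<mu>"
    using z by (auto simp: sets_mu sets_restrict_space intro!: image_eqI[of _ _ "{a..z}"])
  note [measurable] = measurable_continuous[OF h]
  have int: "integrable \<mu> (\<lambda>x. \<bar>h x\<bar>)" "integrable \<mu> (\<lambda>x. \<bar>h x\<bar>\<^sup>2)"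
    by (intro integrable_continuous continuous_intros h)+
  have "\<bar>G z\<bar> = \<bar>LINT x|\<mu>. indicator {a..z} x * h x\<bar>"
    using FTC_mu[OF h G z] assms(3) by simp
  also have "\<dots> \<le> (LINT x|\<mu>. \<bar>indicator {a..z} x * h x\<bar>)" by (rule integral_abs_bound)
  also have "\<dots> \<le> (LINT x|\<mu>. \<bar>h x\<bar>)"
    by (rule integral_mono_AE'[OF int(1)]) (auto simp: indicator_def)
  also have "\<dots> \<le> L2_norm \<mu> h"
    unfolding L2_norm_def L2_inner_def
    using mu.expectation_square_le[OF _ int(2)] by (intro real_le_rsqrt) (simp add: power2_eq_square)
  finally show ?thesis .
qed

lemma L2_norm_zero_imp_zero:
  assumes h: "continuous_on {a..b} h" and zero: "L2_norm \<mu> h = 0" and x: "x \<in> {a..b}"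
  shows "h x = 0"
proof -
  have "continuous_on {a..b} (\<lambda>x. \<rho> x * h x)" by (intro continuous_intros continuous_rho h)
  then obtain G where G: "\<And>x. x \<in> {a..b} \<Longrightarrow> (G has_real_derivative \<rho> x * h x) (at x within {a..b})"
    using antiderivative_continuous[of a b] unfolding has_real_derivative_iff_has_vector_derivative by blast
  have bound: "\<bar>G z - G a\<bar> \<le> L2_norm \<mu> h" if "z \<in> {a..b}" for z
  proof (rule FTC_mu_bound[OF h, of "\<lambda>z. G z - G a"])
    show "((\<lambda>z. G z - G a) has_real_derivative \<rho> x * h x) (at x within {a..b})" if "x \<in> {a..b}" for x
      using DERIV_diff[OF G[OF that] DERIV_const[of "G a"]] by simp
  qed (use that in auto)
  have "G z = G a" if "z \<in> {a..b}" for z using bound[OF that] zero by simp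
  from DERIV_const_on_zero[OF x G[OF x] this] have "\<rho> x * h x = 0" by simp
  then show ?thesis using rho_pos[OF x] by simp
qed

lemma L2_fun_continuous: "continuous_on {a..b} h \<Longrightarrow> h \<in> L2_fun \<mu>"
  unfolding L2_fun_def
  by (auto intro!: measurable_continuous integrable_continuous continuous_intros)

section \<open>Uniform density of the eigenfunctions\<close>

text \<open>Symmetry of the generator: the derivative of \<open>\<rho> (g' F\<^sub>i - g F\<^sub>i')\<close> is
  \<open>\<rho> (q F\<^sub>i + l\<^sub>i g F\<^sub>i)\<close>, where \<open>q\<close> is the image of \<open>g\<close> under the generator, and both ends
  contribute zero.\<close>

lemma green:
  assumes q: "continuous_on {a..b} q"
    and g: "\<And>x. x \<in> {a..b} \<Longrightarrow> (g has_real_derivative g' x) (at x within {a..b})"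
    and G: "\<And>x. x \<in> {a..b} \<Longrightarrow> ((\<lambda>x. \<rho> x * g' x) has_real_derivative \<rho> x * q x) (at x within {a..b})"
    and neumann: "g' a = 0" "g' b = 0"
  shows "coef q i = - l i * coef g i"
proof -
  have g_cont: "continuous_on {a..b} g" by (rule DERIV_continuous_on[OF g])
  note c = q g_cont continuous_F[of i]
  have "((\<lambda>x. \<rho> x * g' x * F i x - g x * flux i x) has_real_derivative
      \<rho> x * (q x * F i x + l i * (g x * F i x))) (at x within {a..b})"
    if x: "x \<in> {a..b}" for x
    using DERIV_diff[OF DERIV_mult[OF G[OF x] DERIV_F[OF x]] DERIV_mult[OF g[OF x] DERIV_flux[OF x]], of i i]
    by (rule DERIV_cong) (simp add: flux_def algebra_simps)
  from FTC_mu[OF _ this, of b]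
  have "(LINT x|\<mu>. indicator {a..b} x * (q x * F i x + l i * (g x * F i x))) = 0"
    using a_less_b neumann by (simp add: c continuous_intros)
  also have "(LINT x|\<mu>. indicator {a..b} x * (q x * F i x + l i * (g x * F i x)))
    = (LINT x|\<mu>. q x * F i x + l i * (g x * F i x))"
    by (intro Bochner_Integration.integral_cong) (auto simp: space_mu)
  also have "\<dots> = coef q i + l i * coef g i"
    unfolding L2_inner_def
    by (subst Bochner_Integration.integral_add)
      (auto intro!: integrable_continuous continuous_intros c)
  finally show ?thesis by simp
qed

text \<open>Let \<open>\<epsilon>\<close> be the remainder of the expansion of \<open>g\<close>. By \<open>green\<close>, \<open>(\<rho> \<epsilon>')' = \<rho> h\<close> with \<open>h\<close>
  the remainder of the expansion of \<open>q\<close>, which tends to \<open>0\<close> in \<open>L\<^sup>2\<close>. Hence \<open>\<epsilon>'\<close> tends to \<open>0\<close> uniformly, and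
  so does \<open>\<epsilon>\<close>, because its mean is zero.\<close>

lemma neumann_uniform_approx:
  assumes q: "continuous_on {a..b} q"
    and g: "\<And>x. x \<in> {a..b} \<Longrightarrow> (g has_real_derivative g' x) (at x within {a..b})"
    and G: "\<And>x. x \<in> {a..b} \<Longrightarrow> ((\<lambda>x. \<rho> x * g' x) has_real_derivative \<rho> x * q x) (at x within {a..b})"
    and neumann: "g' a = 0" "g' b = 0" and e: "0 < e"
  shows "\<exists>n d. \<forall>x\<in>{a..b}. \<bar>g x - (\<Sum>i<n. d i * F i x)\<bar> < e"
proof -
  have g_cont: "continuous_on {a..b} g" by (rule DERIV_continuous_on[OF g])
  obtain m where m: "m > 0" "\<And>x. x \<in> {a..b} \<Longrightarrow> m \<le> \<rho> x"
    using admissible by (auto simp: admissible_density_def)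
  have coef_q: "coef q i = - l i * coef g i" for i by (rule green[OF q g G neumann])
  define h where "h n x = q x - (\<Sum>i<n. coef q i * F i x)" for n x
  have "(\<lambda>n. L2_norm \<mu> (h n)) \<longlonglongrightarrow> 0"
    using onb L2_fun_continuous[OF q] unfolding L2_orthonormal_basis_def h_def by blast
  then have "(\<lambda>n. L2_norm \<mu> (h n) / m * (b - a)) \<longlonglongrightarrow> 0 / m * (b - a)"
    using m(1) by (intro tendsto_intros) auto
  then have "eventually (\<lambda>n. L2_norm \<mu> (h n) / m * (b - a) < e) sequentially"
    using e by (simp add: order_tendstoD(2))
  then obtain n where n: "n > 0" "L2_norm \<mu> (h n) / m * (b - a) < e"
    by (metis (mono_tags, lifting) eventually_conj eventually_gt_at_top eventually_happens' sequentially_bot)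
  define \<epsilon> where "\<epsilon> x = g x - (\<Sum>i<n. coef g i * F i x)" for x
  define \<epsilon>' where "\<epsilon>' x = g' x - (\<Sum>i<n. coef g i * deriv_on a b (F i) x)" for x
  have h_cont: "continuous_on {a..b} (h n)" and \<epsilon>_cont: "continuous_on {a..b} \<epsilon>"
    unfolding h_def \<epsilon>_def by (intro continuous_intros q g_cont continuous_F)+
  have d\<epsilon>: "(\<epsilon> has_real_derivative \<epsilon>' x) (at x within {a..b})" if "x \<in> {a..b}" for x
    unfolding \<epsilon>_def \<epsilon>'_def using that by (intro DERIV_diff DERIV_sum DERIV_cmult g DERIV_F)
  have flux_\<epsilon>: "((\<lambda>x. \<rho> x * \<epsilon>' x) has_real_derivative \<rho> x * h n x) (at x within {a..b})"
    if x: "x \<in> {a..b}" for x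
  proof -
    have eq: "(\<lambda>x. \<rho> x * \<epsilon>' x) = (\<lambda>x. \<rho> x * g' x - (\<Sum>i<n. coef g i * flux i x))"
      by (auto simp: \<epsilon>'_def flux_def algebra_simps sum_distrib_left)
    have "((\<lambda>x. \<rho> x * g' x - (\<Sum>i<n. coef g i * flux i x)) has_real_derivative
        \<rho> x * q x - (\<Sum>i<n. coef g i * (- l i * (\<rho> x * F i x)))) (at x within {a..b})"
      using x by (intro DERIV_diff DERIV_sum DERIV_cmult G DERIV_flux)
    then show ?thesis unfolding eq
      by (rule DERIV_cong) (simp add: h_def coef_q algebra_simps sum_distrib_left sum_negf)
  qed
  have \<epsilon>'_bound: "norm (\<epsilon>' x) \<le> L2_norm \<mu> (h n) / m" if x: "x \<in> {a..b}" for x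
  proof -
    have "\<rho> a * \<epsilon>' a = 0" using neumann eigen by (simp add: \<epsilon>'_def neumann_eigenfunction_def)
    from FTC_mu_bound[OF h_cont flux_\<epsilon> this x] have "\<bar>\<rho> x * \<epsilon>' x\<bar> \<le> L2_norm \<mu> (h n)" .
    moreover have "m * \<bar>\<epsilon>' x\<bar> \<le> \<bar>\<rho> x * \<epsilon>' x\<bar>"
      using m(2)[OF x] m(1) by (simp add: abs_mult mult_right_mono)
    ultimately show ?thesis using m(1) by (simp add: field_simps)
  qed
  have osc: "\<bar>\<epsilon> x - \<epsilon> y\<bar> \<le> L2_norm \<mu> (h n) / m * (b - a)" if "x \<in> {a..b}" "y \<in> {a..b}" for x y
  proof -
    have "norm (\<epsilon> x - \<epsilon> y) \<le> L2_norm \<mu> (h n) / m * norm (x - y)"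
      by (rule field_differentiable_bound[OF _ d\<epsilon> \<epsilon>'_bound that]) auto
    also have "\<dots> \<le> L2_norm \<mu> (h n) / m * (b - a)"
      using that \<epsilon>'_bound[OF that(1)] by (intro mult_left_mono) (auto intro: order_trans[OF norm_ge_zero])
    finally show ?thesis by simp
  qed
  have mean: "integral\<^sup>L \<mu> \<epsilon> = 0"
  proof -
    have "integral\<^sup>L \<mu> \<epsilon> = integral\<^sup>L \<mu> g - (\<Sum>i<n. coef g i * integral\<^sup>L \<mu> (F i))"
      unfolding \<epsilon>_def
      by (subst Bochner_Integration.integral_diff)
        (auto intro!: integrable_continuous continuous_intros g_cont continuous_F
           simp: Bochner_Integration.integral_sum integrable_continuous[OF continuous_F])
    also have "(\<Sum>i<n. coef g i * integral\<^sup>L \<mu> (F i)) = coef g 0"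
      using n(1) by (simp add: integral_F if_distrib cong: if_cong)
    finally show ?thesis by (simp add: inner_F_zero)
  qed
  have "\<bar>\<epsilon> x\<bar> < e" if x: "x \<in> {a..b}" for x
  proof -
    have "\<epsilon> x = (LINT y|\<mu>. \<epsilon> x - \<epsilon> y)"
      using mean integrable_continuous[OF \<epsilon>_cont] by (simp add: mu.prob_space)
    also have "\<bar>\<dots>\<bar> \<le> (LINT y|\<mu>. \<bar>\<epsilon> x - \<epsilon> y\<bar>)" by (rule integral_abs_bound)
    also have "\<dots> \<le> (LINT y|\<mu>. L2_norm \<mu> (h n) / m * (b - a))"
      using osc[OF x] by (intro integral_mono_AE integrable_continuous continuous_intros \<epsilon>_cont)
        (auto simp: space_mu)
    also have "\<dots> < e" using n(2) by (simp add: mu.prob_space)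
    finally show ?thesis .
  qed
  then show ?thesis
    unfolding \<epsilon>_def by (intro exI[of _ n] exI[of _ "coef g"] ballI)
qed

text \<open>The twice continuously differentiable functions with vanishing derivative at both ends form
  an algebra, and the cosine whose half period is the interval belongs to it and separates
  points. So they are dense by the Stone-Weierstrass theorem.\<close>

theorem uniform_approx:
  fixes h :: "real \<Rightarrow> real"
  assumes h: "continuous_on {a..b} h" and e: "0 < e"
  shows "\<exists>n d. \<forall>x\<in>{a..b}. \<bar>h x - (\<Sum>i<n. d i * F i x)\<bar> < e"
proof -
  define P where "P g \<longleftrightarrow> (\<exists>g' g''. (\<forall>x. DERIV g x :> g' x) \<and> (\<forall>x. DERIV g' x :> g'' x) \<and>
     continuous_on UNIV g'' \<and> g' a = 0 \<and> g' b = 0)" for g :: "real \<Rightarrow> real"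
  have P_I: "P g" if "\<And>x. DERIV g x :> g' x" "\<And>x. DERIV g' x :> g'' x"
     "continuous_on UNIV g''" "g' a = 0" "g' b = 0" for g g' g''
    using that unfolding P_def by blast
  have "\<exists>g. P g \<and> (\<forall>x\<in>{a..b}. \<bar>h x - g x\<bar> < e / 2)"
  proof (rule Stone_Weierstrass_HOL[OF _ _ _ _ _ _ h])
    show "P (\<lambda>x. c)" for c by (rule P_I[of _ "\<lambda>_. 0" "\<lambda>_. 0"]) auto
    show "continuous_on {a..b} f" if "P f" for f
      using that unfolding P_def by (auto intro: DERIV_continuous_on has_field_derivative_at_within)
    show "P (\<lambda>x. f x + g x)" if fg: "P f \<and> P g" for f g
    proof -
      obtain f' f'' g' g'' where
        "\<And>x. DERIV f x :> f' x" "\<And>x. DERIV f' x :> f'' x" "continuous_on UNIV f''" "f' a = 0" "f' b = 0"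
        "\<And>x. DERIV g x :> g' x" "\<And>x. DERIV g' x :> g'' x" "continuous_on UNIV g''" "g' a = 0" "g' b = 0"
        using fg unfolding P_def by blast
      then show ?thesis
        by (intro P_I[of _ "\<lambda>x. f' x + g' x" "\<lambda>x. f'' x + g'' x"] DERIV_add continuous_intros) auto
    qed
    show "P (\<lambda>x. f x * g x)" if fg: "P f \<and> P g" for f g
    proof -
      obtain f' f'' g' g'' where d:
        "\<And>x. DERIV f x :> f' x" "\<And>x. DERIV f' x :> f'' x" "continuous_on UNIV f''" "f' a = 0" "f' b = 0"
        "\<And>x. DERIV g x :> g' x" "\<And>x. DERIV g' x :> g'' x" "continuous_on UNIV g''" "g' a = 0" "g' b = 0"
        using fg unfolding P_def by blast
      have c: "continuous_on UNIV f" "continuous_on UNIV g" "continuous_on UNIV f'" "continuous_on UNIV g'"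
        using DERIV_continuous_on[of UNIV] d(1,2,6,7) by blast+
      show ?thesis
        by (rule P_I[OF DERIV_mult[OF d(1) d(6)]
              DERIV_add[OF DERIV_mult[OF d(2) d(6)] DERIV_mult[OF d(7) d(1)]]])
          (intro continuous_intros c d(3) d(8), simp_all add: d(4,5,9,10))
    qed
    show "\<exists>f. P f \<and> f x \<noteq> f y" if xy: "x \<in> {a..b} \<and> y \<in> {a..b} \<and> x \<noteq> y" for x y
    proof -
      define k where "k = pi / (b - a)"
      have k: "k > 0" "k * (b - a) = pi" using a_less_b by (auto simp: k_def)
      define f where "f x = cos (k * (x - a))" for x
      have "P f" unfolding f_def
        by (rule P_I[of _ "\<lambda>x. - sin (k * (x - a)) * k" "\<lambda>x. - (cos (k * (x - a)) * k) * k"])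
          (auto intro!: derivative_eq_intros continuous_intros simp: k)
      moreover have "k * (x - a) \<le> pi" "k * (y - a) \<le> pi"
        using xy k mult_left_mono[of _ "b - a" k] by (metis atLeastAtMost_iff diff_right_mono less_imp_le)+
      then have "f x \<noteq> f y"
        unfolding f_def using cos_inj_pi[of "k * (x - a)" "k * (y - a)"] xy k by auto
      ultimately show ?thesis by blast
    qed
    show "compact {a..b}" by simp
    show "0 < e / 2" using e by simp
  qed
  then obtain g g' g'' where g: "\<And>x. DERIV g x :> g' x" "\<And>x. DERIV g' x :> g'' x"
     "continuous_on UNIV g''" "g' a = 0" "g' b = 0" and hg: "\<And>x. x \<in> {a..b} \<Longrightarrow> \<bar>h x - g x\<bar> < e / 2"
    unfolding P_def by blast
  have "deriv_on a b \<rho> differentiable_on {a..b}"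
    using admissible unfolding admissible_density_def smooth_on_interval_def
    by (metis (no_types) funpow.simps comp_apply funpow_0 id_apply)
  then have r': "continuous_on {a..b} (deriv_on a b \<rho>)" by (rule differentiable_imp_continuous_on)
  have r0: "\<rho> x \<noteq> 0" if "x \<in> {a..b}" for x using rho_pos[OF that] by simp
  have gc: "continuous_on {a..b} g'" by (rule DERIV_continuous_on) (rule has_field_derivative_at_within[OF g(2)])
  have "\<exists>n d. \<forall>x\<in>{a..b}. \<bar>g x - (\<Sum>i<n. d i * F i x)\<bar> < e / 2"
  proof (rule neumann_uniform_approx)
    show "continuous_on {a..b} (\<lambda>x. g'' x + deriv_on a b \<rho> x / \<rho> x * g' x)"
      using r0 by (intro continuous_intros continuous_on_subset[OF g(3)] r' continuous_rho gc) auto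
    show "(g has_real_derivative g' x) (at x within {a..b})" for x
      by (rule has_field_derivative_at_within[OF g(1)])
    show "((\<lambda>x. \<rho> x * g' x) has_real_derivative \<rho> x * (g'' x + deriv_on a b \<rho> x / \<rho> x * g' x))
      (at x within {a..b})" if x: "x \<in> {a..b}" for x
      by (rule DERIV_cong[OF DERIV_mult[OF DERIV_rho[OF x] has_field_derivative_at_within[OF g(2)]]])
        (use r0[OF x] in \<open>simp add: field_simps\<close>)
  qed (use g e in auto)
  then obtain n d where nd: "\<And>x. x \<in> {a..b} \<Longrightarrow> \<bar>g x - (\<Sum>i<n. d i * F i x)\<bar> < e / 2" by blast
  have "\<bar>h x - (\<Sum>i<n. d i * F i x)\<bar> < e" if "x \<in> {a..b}" for x
    using hg[OF that] nd[OF that] by linarith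
  then show ?thesis by blast
qed

lemma integral_near:
  assumes P: "prob_space \<nu>" and sets: "sets \<nu> = sets \<mu>" and h: "continuous_on {a..b} h"
    and near: "\<And>x. x \<in> {a..b} \<Longrightarrow> \<bar>h x - (\<Sum>i<n. d i * F i x)\<bar> < e"
  shows "\<bar>integral\<^sup>L \<nu> h - (\<Sum>i<n. d i * integral\<^sup>L \<nu> (F i))\<bar> \<le> e"
proof -
  interpret prob_space \<nu> by fact
  have intF: "integrable \<nu> (F i)" for i by (rule integrable_of_continuous[OF P sets continuous_F])
  have inth: "integrable \<nu> h" by (rule integrable_of_continuous[OF P sets h])
  have "integral\<^sup>L \<nu> h - (\<Sum>i<n. d i * integral\<^sup>L \<nu> (F i)) = (LINT x|\<nu>. h x - (\<Sum>i<n. d i * F i x))"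
    using inth intF by (simp add: Bochner_Integration.integral_sum)
  also have "\<bar>\<dots>\<bar> \<le> (LINT x|\<nu>. \<bar>h x - (\<Sum>i<n. d i * F i x)\<bar>)" by (rule integral_abs_bound)
  also have "\<dots> \<le> (LINT x|\<nu>. e)"
  proof (rule integral_mono_AE)
    show "AE x in \<nu>. \<bar>h x - (\<Sum>i<n. d i * F i x)\<bar> \<le> e"
      using near by (intro AE_I2) (auto intro: less_imp_le simp: sets_eq_imp_space_eq[OF sets] space_mu)
  qed (use inth intF in auto)
  also have "\<dots> = e" by (simp add: prob_space)
  finally show ?thesis .
qed

lemma measure_eqI_moments:
  assumes P: "prob_space \<nu>" "prob_space \<nu>'" and sets: "sets \<nu> = sets \<mu>" "sets \<nu>' = sets \<mu>"
    and eq: "\<And>i. integral\<^sup>L \<nu> (F i) = integral\<^sup>L \<nu>' (F i)"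
  shows "\<nu> = \<nu>'"
proof (rule measure_eqI_continuous[OF P])
  show "integral\<^sup>L \<nu> h = integral\<^sup>L \<nu>' h" if h: "continuous_on {a..b} h" for h :: "real \<Rightarrow> real"
  proof (rule ccontr)
    assume ne: "integral\<^sup>L \<nu> h \<noteq> integral\<^sup>L \<nu>' h"
    define e where "e = \<bar>integral\<^sup>L \<nu> h - integral\<^sup>L \<nu>' h\<bar> / 3"
    have e: "0 < e" using ne by (simp add: e_def)
    obtain n d where "\<And>x. x \<in> {a..b} \<Longrightarrow> \<bar>h x - (\<Sum>i<n. d i * F i x)\<bar> < e"
      using uniform_approx[OF h e] by blast
    from integral_near[OF P(1) sets(1) h this] integral_near[OF P(2) sets(2) h this]
    have "\<bar>integral\<^sup>L \<nu> h - integral\<^sup>L \<nu>' h\<bar> \<le> 2 * e" by (simp add: eq)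
    then show False using e by (simp add: e_def)
  qed
qed (use sets sets_mu in auto)

end

section \<open>From positive products to the hypergroup property\<close>

text \<open>The analytic input to the hypergroup property: positivity of the solution of the
  two-variable equation with nonnegative data on the side \<open>y = a\<close>.\<close>

locale product_positive = neumann_spectrum +
  assumes product_nonneg: "\<And>n d x y. x \<in> {a..b} \<Longrightarrow> y \<in> {a..b} \<Longrightarrow>
    (\<And>z. z \<in> {a..b} \<Longrightarrow> 0 \<le> (\<Sum>i<n. d i * F i z)) \<Longrightarrow> 0 \<le> (\<Sum>i<n. d i * (F i x * F i y / F i a))"
begin

lemma product_measure_exists:
  assumes "x \<in> {a..b}" "y \<in> {a..b}"
  shows "\<exists>\<nu>. prob_space \<nu> \<and> sets \<nu> = sets \<mu> \<and> (\<forall>i. integral\<^sup>L \<nu> (F i) = F i x * F i y / F i a)"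
  unfolding sets_mu
  using assms a_less_b
  by (intro moment_problem_Icc product_nonneg uniform_approx continuous_F) (auto simp: F_zero)

text \<open>The choice is unique, because a probability measure is determined by its integrals of the
  \<open>F i\<close>.\<close>

definition product_measure :: "real \<Rightarrow> real \<Rightarrow> real measure" where
  "product_measure x y = (SOME \<nu>. prob_space \<nu> \<and> sets \<nu> = sets \<mu> \<and>
     (\<forall>i. integral\<^sup>L \<nu> (F i) = F i x * F i y / F i a))"

lemma product_measure:
  assumes "x \<in> {a..b}" "y \<in> {a..b}"
  shows "prob_space (product_measure x y)" "sets (product_measure x y) = sets \<mu>"
    "integral\<^sup>L (product_measure x y) (F i) = F i x * F i y / F i a"
  using someI_ex[OF product_measure_exists[OF assms]] unfolding product_measure_def by blast+

text \<open>Integrals of continuous functions are limits in \<open>y\<close> of combinations of the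
  continuous functions \<open>F i\<close>, and measures of initial segments are limits of integrals of continuous
  functions.\<close>

lemma product_kernel_measurable:
  assumes x: "x \<in> {a..b}"
  shows "product_measure x \<in> measurable \<mu> (prob_algebra \<mu>)"
proof (rule measurable_prob_algebra_generated)
  show "sets \<mu> = sigma_sets {a..b} (range (\<lambda>c. {a..b} \<inter> {..c}))"
    by (simp add: sets_mu sets_restrict_borel_Icc)
  show "Int_stable (range (\<lambda>c. {a..b} \<inter> {..c}))" by (rule Int_stable_initial_segments)
  show "range (\<lambda>c. {a..b} \<inter> {..c}) \<subseteq> Pow {a..b}" by auto
  fix A assume "A \<in> range (\<lambda>c. {a..b} \<inter> {..c})"
  then obtain c where A: "A = {a..b} \<inter> {..c}" by auto
  have cont: "(\<lambda>y. integral\<^sup>L (product_measure x y) h) \<in> borel_measurable \<mu>"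
    if h: "continuous_on {a..b} h" for h :: "real \<Rightarrow> real"
  proof -
    have "\<forall>m. \<exists>n d. \<forall>z\<in>{a..b}. \<bar>h z - (\<Sum>i<n. d i * F i z)\<bar> < 1 / real (Suc m)"
      using uniform_approx[OF h] by simp
    then obtain N d where nd: "\<And>m z. z \<in> {a..b} \<Longrightarrow> \<bar>h z - (\<Sum>i<N m. d m i * F i z)\<bar> < 1 / real (Suc m)"
      by metis
    show ?thesis
    proof (rule borel_measurable_LIMSEQ_real)
      show "(\<lambda>y. \<Sum>i<N m. d m i * (F i x * F i y / F i a)) \<in> borel_measurable \<mu>" for m
        using F_pos by (intro measurable_continuous continuous_intros continuous_F) (auto simp: less_imp_neq[symmetric])
      fix y assume "y \<in> space \<mu>"
      then have y: "y \<in> {a..b}" by (simp add: space_mu)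
      show "(\<lambda>m. \<Sum>i<N m. d m i * (F i x * F i y / F i a)) \<longlonglongrightarrow> integral\<^sup>L (product_measure x y) h"
      proof (rule LIM_zero_cancel, rule Lim_null_comparison)
        show "\<forall>\<^sub>F m in sequentially. norm ((\<Sum>i<N m. d m i * (F i x * F i y / F i a))
            - integral\<^sup>L (product_measure x y) h) \<le> 1 / real (Suc m)"
          using integral_near[OF product_measure(1,2)[OF x y] h nd]
          by (intro always_eventually allI) (simp add: product_measure(3)[OF x y] abs_minus_commute)
        show "(\<lambda>m. 1 / real (Suc m)) \<longlonglongrightarrow> 0" by (rule LIMSEQ_Suc[OF lim_1_over_n])
      qed
    qed
  qed
  have "(\<lambda>y. measure (product_measure x y) A) \<in> borel_measurable \<mu>"
    unfolding A
  proof (rule borel_measurable_LIMSEQ_real)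
    fix y assume "y \<in> space \<mu>"
    then have y: "y \<in> {a..b}" by (simp add: space_mu)
    show "(\<lambda>n. integral\<^sup>L (product_measure x y) (ramp c n)) \<longlonglongrightarrow> measure (product_measure x y) ({a..b} \<inter> {..c})"
      using product_measure(1,2)[OF x y] by (intro measure_initial_segment_lim) (auto simp: sets_mu)
  qed (rule cont[OF continuous_ramp])
  then have "(\<lambda>y. ennreal (measure (product_measure x y) A)) \<in> borel_measurable \<mu>" by measurable
  also have "?this \<longleftrightarrow> (\<lambda>y. emeasure (product_measure x y) A) \<in> borel_measurable \<mu>"
  proof (rule measurable_cong)
    fix y assume "y \<in> space \<mu>"
    then interpret prob_space "product_measure x y"
      using product_measure(1)[OF x] by (simp add: space_mu)
    show "ennreal (measure (product_measure x y) A) = emeasure (product_measure x y) A"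
      by (simp add: emeasure_eq_measure)
  qed
  finally show "(\<lambda>y. emeasure (product_measure x y) A) \<in> borel_measurable \<mu>" .
qed (use product_measure[OF x] in \<open>auto simp: space_mu\<close>)

text \<open>Averaging the kernel over \<open>y\<close> multiplies the integral of \<open>F i\<close> by \<open>F i x / F i a\<close>. This factor is \<open>1\<close>
  for \<open>i = 0\<close>, and the integral is zero for all other \<open>i\<close>, so all moments are preserved.\<close>

lemma invariant_kernel_product:
  assumes x: "x \<in> {a..b}"
  shows "invariant_kernel \<mu> (product_measure x)"
proof
  note k = product_kernel_measurable[OF x]
  show "product_measure x \<in> measurable \<mu> (prob_algebra \<mu>)" by (rule k)
  have k': "product_measure x \<in> measurable \<mu> (subprob_algebra \<mu>)" by (rule measurable_prob_algebraD[OF k])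
  have P: "prob_space (\<mu> \<bind> product_measure x)"
    using product_measure(1)[OF x] by (intro mu.prob_space_bind[OF _ k'] AE_I2) (simp add: space_mu)
  have sets: "sets (\<mu> \<bind> product_measure x) = sets \<mu>"
    using product_measure(2)[OF x] mu.not_empty by (intro sets_bind) (simp_all add: space_mu)
  show "\<mu> \<bind> product_measure x = \<mu>"
  proof (rule measure_eqI_moments[OF P mu.prob_space_axioms sets refl])
    fix i
    obtain B where B: "\<And>z. z \<in> {a..b} \<Longrightarrow> \<bar>F i z\<bar> \<le> B"
      using compact_imp_bounded[OF compact_continuous_image[OF continuous_F[of i] compact_Icc]]
      unfolding bounded_iff by force
    have "integral\<^sup>L (\<mu> \<bind> product_measure x) (F i) = (LINT y|\<mu>. integral\<^sup>L (product_measure x y) (F i))"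
    proof (rule integral_bind[OF measurable_continuous[OF continuous_F] _ k'])
      show "\<bar>F i z\<bar> \<le> B" if "z \<in> space \<mu>" for z using B that by (simp add: space_mu)
      show "finite_measure \<mu>" by unfold_locales
      show "AE y in \<mu>. emeasure (product_measure x y) (space (product_measure x y)) \<le> ennreal 1"
        using product_measure(1)[OF x] by (intro AE_I2) (simp add: space_mu prob_space.emeasure_space_1)
    qed
    also have "\<dots> = (LINT y|\<mu>. F i x / F i a * F i y)"
      using product_measure(3)[OF x] by (intro Bochner_Integration.integral_cong) (auto simp: space_mu)
    also have "\<dots> = F i x / F i a * integral\<^sup>L \<mu> (F i)" by simp
    also have "\<dots> = integral\<^sup>L \<mu> (F i)"
      using x a_less_b by (simp add: integral_F F_zero)
    finally show "integral\<^sup>L (\<mu> \<bind> product_measure x) (F i) = integral\<^sup>L \<mu> (F i)" .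
  qed
qed

theorem hypergroup_left: "hypergroup_property a b \<mu> F a"
  unfolding hypergroup_property_def
proof (intro conjI allI ballI)
  show "a \<in> {a..b}" using a_less_b by simp
  show "F i a \<noteq> 0" for i using F_pos[of i] by simp
  fix x assume x: "x \<in> {a..b}"
  interpret K: invariant_kernel \<mu> "product_measure x" by (rule invariant_kernel_product[OF x])
  have diag: "AE y in \<mu>. K.kernel_op (F i) y = F i x / F i a * F i y" for i
    using product_measure(3)[OF x] by (intro AE_I2) (simp add: space_mu K.kernel_op_def)
  show "\<exists>K. markov_operator \<mu> K \<and> (\<forall>i. AE y in \<mu>. K (F i) y = F i x / F i a * F i y)"
    using K.markov_operator_kernel_op[OF onb diag] diag by blast
qed

end

section \<open>Increasing densities\<close>

text \<open>An increasing density has \<open>log_deriv \<ge> 0\<close>, so the maximum principle works in the whole triangle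
  \<open>y \<le> x\<close>; the other triangle is its mirror image.\<close>

lemma (in neumann_spectrum) product_positive_increasing:
  assumes lc: "log_concave_on {a..b} \<rho>" and mono: "mono_on {a..b} \<rho>"
  shows "product_positive a b \<rho> F l"
proof
  fix n d x y
  assume xy: "x \<in> {a..b}" "y \<in> {a..b}" and nn: "\<And>z. z \<in> {a..b} \<Longrightarrow> 0 \<le> (\<Sum>i<n. d i * F i z)"
  have pos: "0 \<le> log_deriv z" if z: "a < z" "z < b" for z
  proof -
    have "0 \<le> deriv_on a b \<rho> z"
      using mono_on_imp_deriv_nonneg[OF mono DERIV_interior[OF DERIV_rho]] z by auto
    then show ?thesis using rho_pos[of z] z by (simp add: log_deriv_def)
  qed
  have ordered: "0 \<le> (\<Sum>i<n. d i * (F i x * F i y / F i a))" if "a \<le> y" "y \<le> x" "x \<le> b" for x y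
    using that by (intro wave_nonneg[where c = "2 * b"] log_deriv_antimono[OF lc] nn) (auto intro!: add_nonneg_nonneg pos)
  show "0 \<le> (\<Sum>i<n. d i * (F i x * F i y / F i a))"
    using ordered[of y x] ordered[of x y] xy by (cases "y \<le> x") (auto simp: mult.commute)
qed

section \<open>Symmetric densities\<close>

context neumann_spectrum
begin

lemma DERIV_reflect:
  assumes sym: "a = - b" and x: "x \<in> {a..b}"
    and f: "\<And>x. x \<in> {a..b} \<Longrightarrow> (f has_real_derivative f' x) (at x within {a..b})"
  shows "((\<lambda>x. f (- x)) has_real_derivative - f' (- x)) (at x within {a..b})"
proof -
  have "- x \<in> {a..b}" and img: "uminus ` {a..b} = {a..b}" using x sym by auto
  then have "(f has_real_derivative f' (- x)) (at (- x) within uminus ` {a..b})" using f by simp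
  from DERIV_image_chain[OF this DERIV_minus[OF DERIV_ident]] show ?thesis
    by (simp add: comp_def)
qed

text \<open>The reflected eigenfunction is a Neumann function for the same eigenvalue. By \<open>green\<close> it is
  orthogonal to all \<open>F j\<close> with \<open>j \<noteq> i\<close>, so completeness of the basis makes it a multiple of
  \<open>F i\<close>.\<close>

lemma eigenfunction_parity:
  assumes sym: "a = - b" and even: "\<And>x. x \<in> {a..b} \<Longrightarrow> \<rho> (- x) = \<rho> x"
  shows "\<exists>s. s * s = 1 \<and> (\<forall>x\<in>{a..b}. F i (- x) = s * F i x)"
proof -
  define g where "g x = F i (- x)" for x
  have dg: "(g has_real_derivative - deriv_on a b (F i) (- x)) (at x within {a..b})" if "x \<in> {a..b}" for x
    unfolding g_def using that by (rule DERIV_reflect[OF sym _ DERIV_F])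
  have g_cont: "continuous_on {a..b} g" by (rule DERIV_continuous_on[OF dg])
  have dG: "((\<lambda>x. \<rho> x * - deriv_on a b (F i) (- x)) has_real_derivative \<rho> x * (- l i * g x)) (at x within {a..b})"
    if x: "x \<in> {a..b}" for x
  proof -
    have "((\<lambda>x. - flux i (- x)) has_real_derivative - (- (- l i * (\<rho> (- x) * F i (- x))))) (at x within {a..b})"
      using x by (intro DERIV_minus DERIV_reflect[OF sym] DERIV_flux)
    then have "((\<lambda>x. - flux i (- x)) has_real_derivative \<rho> x * (- l i * g x)) (at x within {a..b})"
      using even[OF x] by (simp add: g_def mult.left_commute)
    then show ?thesis
      by (rule has_field_derivative_transform_within[OF _ zero_less_one x]) (simp add: flux_def even)
  qed
  have q: "continuous_on {a..b} (\<lambda>x. - l i * g x)" by (intro continuous_intros g_cont)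
  have ends: "deriv_on a b (F i) a = 0" "deriv_on a b (F i) b = 0" "- a = b" "- b = a"
    using eigen[of i] sym by (auto simp: neumann_eigenfunction_def)
  have coef_g: "coef g j = 0" if "j \<noteq> i" for j
  proof -
    have "coef (\<lambda>x. - l i * g x) j = - l j * coef g j"
      by (rule green[OF q dg dG]) (simp_all add: ends)
    then have "l i * coef g j = l j * coef g j"
      by (simp add: L2_inner_def mult.assoc)
    moreover have "l i \<noteq> l j" using that strict_mono_eq[OF l_strict_mono, of i j] by auto
    ultimately show ?thesis by simp
  qed
  define c where "c = coef g i"
  have "(\<lambda>n. L2_norm \<mu> (\<lambda>x. g x - (\<Sum>j<n. coef g j * F j x))) \<longlonglongrightarrow> 0"
    using onb L2_fun_continuous[OF g_cont] unfolding L2_orthonormal_basis_def by blast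
  moreover have "(\<Sum>j<n. coef g j * F j x) = c * F i x" if "i < n" for n x
  proof -
    have "(\<Sum>j<n. coef g j * F j x) = (\<Sum>j\<in>{i}. coef g j * F j x)"
      using that by (intro sum.mono_neutral_right) (auto simp: coef_g)
    then show ?thesis by (simp add: c_def)
  qed
  then have "eventually (\<lambda>n. L2_norm \<mu> (\<lambda>x. g x - (\<Sum>j<n. coef g j * F j x)) = L2_norm \<mu> (\<lambda>x. g x - c * F i x)) sequentially"
    by (intro eventually_mono[OF eventually_gt_at_top[of i]]) simp
  ultimately have "(\<lambda>n::nat. L2_norm \<mu> (\<lambda>x. g x - c * F i x)) \<longlonglongrightarrow> 0"
    by (rule Lim_transform_eventually)
  then have "L2_norm \<mu> (\<lambda>x. g x - c * F i x) = 0" by (simp add: LIMSEQ_const_iff)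
  then have gc: "F i (- x) = c * F i x" if "x \<in> {a..b}" for x
    using L2_norm_zero_imp_zero[of "\<lambda>x. g x - c * F i x" x] that g_cont continuous_F[of i]
    by (auto simp: g_def continuous_intros)
  have "F i b = c * F i a" "F i a = c * F i b"
    using gc[of a] gc[of b] a_less_b unfolding ends by simp_all
  then have "F i a = c * (c * F i a)" by (rule subst)
  then have "c * c = 1" using F_pos[of i] by simp
  then show ?thesis using gc by (intro exI[of _ c]) simp
qed

lemma log_deriv_odd:
  assumes sym: "a = - b" and even: "\<And>x. x \<in> {a..b} \<Longrightarrow> \<rho> (- x) = \<rho> x" and x: "x \<in> {a..b}"
  shows "log_deriv (- x) = - log_deriv x"
proof -
  have "((\<lambda>x. \<rho> (- x) - \<rho> x) has_real_derivative - deriv_on a b \<rho> (- x) - deriv_on a b \<rho> x) (at x within {a..b})"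
    using x by (intro DERIV_diff DERIV_reflect[OF sym] DERIV_rho)
  from DERIV_const_on_zero[OF x this, of 0] have "deriv_on a b \<rho> (- x) = - deriv_on a b \<rho> x"
    by (simp add: even)
  then show ?thesis using even[OF x] by (simp add: log_deriv_def)
qed

text \<open>In the lower quarter \<open>y \<le> - \<bar>x\<bar>\<close> the condition \<open>log_deriv x + log_deriv y \<ge> 0\<close> says
  \<open>log_deriv (- x) \<le> log_deriv y\<close>, since \<open>log_deriv\<close> is odd; this is log-concavity again. The reflections in the two
  diagonals carry this quarter to the other three.\<close>

lemma product_positive_symmetric:
  assumes sym: "a = - b" and even: "\<And>x. x \<in> {a..b} \<Longrightarrow> \<rho> (- x) = \<rho> x"
    and lc: "log_concave_on {a..b} \<rho>"
  shows "product_positive a b \<rho> F l"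
proof
  fix n d x y
  assume xy: "x \<in> {a..b}" "y \<in> {a..b}" and nn: "\<And>z. z \<in> {a..b} \<Longrightarrow> 0 \<le> (\<Sum>i<n. d i * F i z)"
  define V where "V x y = (\<Sum>i<n. d i * (F i x * F i y / F i a))" for x y
  have swap: "V x y = V y x" for x y by (simp add: V_def mult.commute)
  have reflect: "V (- x) (- y) = V x y" if "x \<in> {a..b}" "y \<in> {a..b}" for x y
    unfolding V_def
  proof (rule sum.cong[OF refl])
    fix i
    obtain s where s: "s * s = 1" "\<And>x. x \<in> {a..b} \<Longrightarrow> F i (- x) = s * F i x"
      using eigenfunction_parity[OF sym even, of i] by blast
    have "F i (- x) * F i (- y) = (s * s) * (F i x * F i y)" using s(2) that by simp
    then show "d i * (F i (- x) * F i (- y) / F i a) = d i * (F i x * F i y / F i a)" by (simp add: s(1))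
  qed
  have below: "0 \<le> V x y" if "a \<le> y" "y \<le> x" "x \<le> b" "x + y \<le> 0" for x y
    unfolding V_def
  proof (rule wave_nonneg[where c = 0])
    fix x y assume xy: "a < y" "y \<le> x" "x < b" "x + y \<le> 0"
    then have "log_deriv (- x) \<le> log_deriv y" using sym by (intro log_deriv_antimono[OF lc]) auto
    then show "0 \<le> log_deriv x + log_deriv y"
      using log_deriv_odd[OF sym even, of x] xy by simp
  qed (fact log_deriv_antimono[OF lc] nn that)+
  consider "y \<le> x" "x + y \<le> 0" | "x \<le> y" "x + y \<le> 0" | "y \<le> x" "0 \<le> x + y" | "x \<le> y" "0 \<le> x + y"
    by linarith
  then show "0 \<le> (\<Sum>i<n. d i * (F i x * F i y / F i a))"
    unfolding V_def[symmetric]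
  proof cases
    case 1
    then show "0 \<le> V x y" using below xy by simp
  next
    case 2
    then show "0 \<le> V x y" using below[of x y] swap xy by simp
  next
    case 3
    then have "0 \<le> V (- y) (- x)" using xy sym by (intro below) auto
    then show "0 \<le> V x y" using reflect[of y x] swap xy by simp
  next
    case 4
    then have "0 \<le> V (- x) (- y)" using xy sym by (intro below) auto
    then show "0 \<le> V x y" using reflect[of x y] xy by simp
  qed
qed

text \<open>By parity, \<open>F i x / F i b = F i (- x) / F i a\<close>: the operators attached to \<open>b\<close> are those
  attached to \<open>a\<close>, taken at the reflected points.\<close>

lemma hypergroup_reflect:
  assumes sym: "a = - b" and even: "\<And>x. x \<in> {a..b} \<Longrightarrow> \<rho> (- x) = \<rho> x"
    and hyp: "hypergroup_property a b \<mu> F a"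
  shows "hypergroup_property a b \<mu> F b"
proof -
  have ab: "a \<in> {a..b}" "b \<in> {a..b}" using a_less_b by auto
  have ratio: "F i b \<noteq> 0 \<and> F i x / F i b = F i (- x) / F i a" if x: "x \<in> {a..b}" for i x
  proof -
    obtain s where s: "s * s = 1" "\<And>x. x \<in> {a..b} \<Longrightarrow> F i (- x) = s * F i x"
      using eigenfunction_parity[OF sym even, of i] by blast
    have s0: "s \<noteq> 0" using s(1) by auto
    have b: "F i b = s * F i a" using s(2)[OF ab(1)] sym by simp
    have "F i x / F i b = (s * s) * F i x / F i b" by (simp add: s(1))
    also have "\<dots> = F i (- x) / F i a" using s0 F_pos[of i] by (simp add: b s(2)[OF x])
    finally show ?thesis using s0 F_pos[of i] by (simp add: b)
  qed
  show ?thesis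
    unfolding hypergroup_property_def
  proof (intro conjI allI ballI)
    show "F i b \<noteq> 0" for i using ratio[OF ab(1)] by blast
    fix x assume x: "x \<in> {a..b}"
    then have "- x \<in> {a..b}" using sym by auto
    then show "\<exists>K. markov_operator \<mu> K \<and> (\<forall>i. AE y in \<mu>. K (F i) y = F i x / F i b * F i y)"
      using hyp ratio[OF x] unfolding hypergroup_property_def by auto
  qed (use ab in auto)
qed

end

section \<open>The hypergroup property\<close>

lemma natural_UOB_neumann_spectrum:
  assumes "admissible_density a b \<rho>" "natural_UOB a b \<rho> F"
  obtains l where "neumann_spectrum a b \<rho> F l"
proof -
  obtain l :: "nat \<Rightarrow> real" where "l 0 = 0" "strict_mono l"
      "\<forall>i. neumann_eigenfunction a b \<rho> (l i) (F i)"
    using assms(2) unfolding natural_UOB_def by (elim conjE exE)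
  then have "neumann_spectrum a b \<rho> F l"
    using assms by (intro neumann_spectrum.intro) (simp_all add: natural_UOB_def)
  then show thesis by (rule that)
qed

theorem theorem4p2:
  "(\<forall>(b::real) (\<rho>::real \<Rightarrow> real) (F::nat \<Rightarrow> real \<Rightarrow> real).
      b > 0 \<longrightarrow>
      admissible_density (-b) b \<rho> \<longrightarrow>
      log_concave_on {-b..b} \<rho> \<longrightarrow>
      (\<forall>x \<in> {-b..b}. \<rho> (-x) = \<rho> x) \<longrightarrow>
      natural_UOB (-b) b \<rho> F \<longrightarrow>
      hypergroup_property (-b) b (density_measure (-b) b \<rho>) F (-b) \<and>
      hypergroup_property (-b) b (density_measure (-b) b \<rho>) F b) \<and>
   (\<forall>(a::real) (b::real) (\<rho>::real \<Rightarrow> real) (F::nat \<Rightarrow> real \<Rightarrow> real).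
      admissible_density a b \<rho> \<longrightarrow>
      log_concave_on {a..b} \<rho> \<longrightarrow>
      mono_on {a..b} \<rho> \<longrightarrow>
      natural_UOB a b \<rho> F \<longrightarrow>
      hypergroup_property a b (density_measure a b \<rho>) F a)"
proof (intro conjI allI impI)
  fix b :: real and \<rho> :: "real \<Rightarrow> real" and F :: "nat \<Rightarrow> real \<Rightarrow> real"
  assume "admissible_density (-b) b \<rho>" and lc: "log_concave_on {-b..b} \<rho>"
    and even: "\<forall>x \<in> {-b..b}. \<rho> (-x) = \<rho> x" and "natural_UOB (-b) b \<rho> F"
  from this(1,4) obtain l where "neumann_spectrum (-b) b \<rho> F l" by (rule natural_UOB_neumann_spectrum)
  then interpret neumann_spectrum "-b" b \<rho> F l .
  interpret product_positive "-b" b \<rho> F l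
    using even by (intro product_positive_symmetric lc) auto
  show "hypergroup_property (-b) b (density_measure (-b) b \<rho>) F (-b)" by (rule hypergroup_left)
  then show "hypergroup_property (-b) b (density_measure (-b) b \<rho>) F b"
    using even by (intro hypergroup_reflect) auto
next
  fix a b :: real and \<rho> :: "real \<Rightarrow> real" and F :: "nat \<Rightarrow> real \<Rightarrow> real"
  assume "admissible_density a b \<rho>" and lc: "log_concave_on {a..b} \<rho>"
    and mono: "mono_on {a..b} \<rho>" and "natural_UOB a b \<rho> F"
  from this(1,4) obtain l where "neumann_spectrum a b \<rho> F l" by (rule natural_UOB_neumann_spectrum)
  then interpret neumann_spectrum a b \<rho> F l .
  interpret product_positive a b \<rho> F l by (rule product_positive_increasing[OF lc mono])
  show "hypergroup_property a b (density_measure a b \<rho>) F a" by (rule hypergroup_left)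
qed

end
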